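(* Let $k\ge 1$ and $m\ge 1$ be integers. There is an equivariant bijection from $\mathcal{Z}_m^k$, the set of alcoves in the $m$-fold dilation of the fundamental alcove of type $A_k$ with its cyclic action of order $k+1$ (generated by $\rho$), to $\mathcal{W}_m^k$, the set of words of length $k+1$ on $\mathbb{Z}/m\mathbb{Z}$ with sum $m-1 \pmod m$, under rotation. That is, there is a bijection $F:\mathcal{Z}_m^k\to\mathcal{W}_m^k$ such that $F(\rho(A))$ is the left rotation of $F(A)$ for every $A\in\mathcal{Z}_m^k$.
   Context: Let $\alpha_1,\dots,\alpha_k$ be simple roots of the root system $\Phi$ of type $A_k$ in a $k$-dimensional real vector space $V$ with positive definite symmetric bilinear form $\langle\cdot,\cdot\rangle$ (normalized so that $\langle\alpha,\alpha\rangle=2$ for all roots), and let $\alpha_0=-\sum_{i=1}^k\alpha_i$ be the negative of the highest root. For $v\in V$, $p\in\mathbb{Z}$ put $H_{v,p}=\{x\in V:\langle v,x\rangle=p\}$. The alcoves are the connected components of $V\setminus\bigcup_{\alpha\in\Phi,\,p\in\mathbb{Z}}H_{\alpha,p}$. The fundamental alcove is the one contained in $\{x:\langle\alpha_i,x\rangle\ge 0\ (1\le i\le k),\ \langle-\alpha_0,x\rangle\le 1\}$. $\mathcal{Z}_m^k$ is the set of (the $m^k$) alcoves contained in the $m$-fold dilation of the fundamental alcove, i.e. in the simplex $\{x:\langle\alpha_i,x\rangle\ge 0\ (1\le i\le k),\ \langle-\alpha_0,x\rangle\le m\}$. Cyclic action on $\mathcal{Z}_m^k$: this simplex has vertices $v_0=0$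 and $v_1,\dots,v_k$, where $\langle\alpha_j,v_i\rangle=m\,\delta_{ij}$ for $1\le i,j\le k$. Let $\rho$ be the affine map of $V$ with $\rho(v_i)=v_{i+1}$, indices mod $k+1$ (equivalently, the affine isometry whose linear part cyclically permutes $\alpha_0,\alpha_1,\dots,\alpha_k$). It permutes the hyperplanes $H_{\alpha,p}$ and the alcoves in the simplex, and generates a cyclic action of order $k+1$ on $\mathcal{Z}_m^k$. $\mathcal{W}_m^k$ is the set of words $w_1w_2\cdots w_{k+1}$ with letters in $\mathbb{Z}/m\mathbb{Z}$ and $\sum_i w_i\equiv m-1\pmod m$; the cyclic group $C_{k+1}$ acts on it by left rotation $w_1w_2\cdots w_{k+1}\mapsto w_2\cdots w_{k+1}w_1$. *)

theory Defs
  imports "HOL-Analysis.Analysis" "HOL-Number_Theory.Cong"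
begin

definition reflect :: "'a::real_inner \<Rightarrow> 'a \<Rightarrow> 'a" where
  "reflect r x = x - (2 * (r \<bullet> x) / (r \<bullet> r)) *\<^sub>R r"

text \<open>Reduced crystallographic root systems in the ambient Euclidean space.\<close>

definition root_system :: "'a::euclidean_space set \<Rightarrow> bool" where
  "root_system \<Phi> \<longleftrightarrow>
     finite \<Phi> \<and> 0 \<notin> \<Phi> \<and> span \<Phi> = UNIV \<and>
     (\<forall>r\<in>\<Phi>. \<forall>s\<in>\<Phi>. reflect r s \<in> \<Phi>) \<and>
     (\<forall>r\<in>\<Phi>. \<forall>s\<in>\<Phi>. 2 * (r \<bullet> s) / (r \<bullet> r) \<in> \<int>) \<and>
     (\<forall>r\<in>\<Phi>. \<forall>c. c *\<^sub>R r \<in> \<Phi> \<longrightarrow> c = 1 \<or> c = - 1)"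

definition simple_roots :: "'a::euclidean_space set \<Rightarrow> nat \<Rightarrow> (nat \<Rightarrow> 'a) \<Rightarrow> bool" where
  "simple_roots \<Phi> k \<alpha> \<longleftrightarrow>
     inj_on \<alpha> {1..k} \<and> \<alpha> ` {1..k} \<subseteq> \<Phi> \<and>
     independent (\<alpha> ` {1..k}) \<and> span (\<alpha> ` {1..k}) = UNIV \<and>
     (\<forall>r\<in>\<Phi>. \<exists>c :: nat \<Rightarrow> int.
        r = (\<Sum>i=1..k. of_int (c i) *\<^sub>R \<alpha> i) \<and>
        ((\<forall>i\<in>{1..k}. 0 \<le> c i) \<or> (\<forall>i\<in>{1..k}. c i \<le> 0)))"

text \<open>The Cartan matrix of the simple roots is that of type \<open>A\<^sub>k\<close>, with the nodes of the
  Dynkin diagram numbered along the path.\<close>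

definition cartan_type_A :: "nat \<Rightarrow> (nat \<Rightarrow> 'a::real_inner) \<Rightarrow> bool" where
  "cartan_type_A k \<alpha> \<longleftrightarrow>
     (\<forall>i\<in>{1..k}. \<forall>j\<in>{1..k}.
        2 * (\<alpha> i \<bullet> \<alpha> j) / (\<alpha> i \<bullet> \<alpha> i) =
          (if i = j then 2 else if i = j + 1 \<or> j = i + 1 then - 1 else 0))"

definition alpha0 :: "nat \<Rightarrow> (nat \<Rightarrow> 'a::real_inner) \<Rightarrow> 'a" where
  "alpha0 k \<alpha> = - (\<Sum>i=1..k. \<alpha> i)"

definition hyperplane :: "'a::real_inner \<Rightarrow> int \<Rightarrow> 'a set" where
  "hyperplane v p = {x. v \<bullet> x = of_int p}"

definition alcoves :: "'a::euclidean_space set \<Rightarrow> 'a set set" where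
  "alcoves \<Phi> = components (UNIV - (\<Union>r\<in>\<Phi>. \<Union>p. hyperplane r p))"

definition dilated_simplex :: "nat \<Rightarrow> (nat \<Rightarrow> 'a::real_inner) \<Rightarrow> nat \<Rightarrow> 'a set" where
  "dilated_simplex k \<alpha> m =
     {x. (\<forall>i\<in>{1..k}. 0 \<le> \<alpha> i \<bullet> x) \<and> (- alpha0 k \<alpha>) \<bullet> x \<le> real m}"

definition dilated_alcoves ::
    "'a::euclidean_space set \<Rightarrow> nat \<Rightarrow> (nat \<Rightarrow> 'a) \<Rightarrow> nat \<Rightarrow> 'a set set" where
  "dilated_alcoves \<Phi> k \<alpha> m = {A \<in> alcoves \<Phi>. A \<subseteq> dilated_simplex k \<alpha> m}"

definition affine_map :: "('a::real_vector \<Rightarrow> 'b::real_vector) \<Rightarrow> bool" where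
  "affine_map f \<longleftrightarrow> (\<exists>g c. linear g \<and> (\<forall>x. f x = g x + c))"

text \<open>Letters of \<open>\<int>/m\<int>\<close> are given by their representatives \<open>0, \<dots>, m - 1\<close>.\<close>

definition words :: "nat \<Rightarrow> nat \<Rightarrow> nat list set" where
  "words k m = {w. length w = k + 1 \<and> set w \<subseteq> {..<m} \<and> [sum_list w = m - 1] (mod m)}"

end

theory Submission
  imports Defs
begin

text \<open>
  Put \<open>n = k + 1\<close>. Recording the partial sums of the barycentric coordinates of a point turns
  \<open>\<rho>\<close> into an index shift, and the roots into differences of partial sums. Every alcove contains
  exactly one point whose partial sums are multiples of \<open>1 / n\<close>; scaled by \<open>n\<close> these are strictly
  increasing integer sequences \<open>P\<close> with \<open>P (i + n) = P i + m n\<close> that hit every residue class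
  modulo \<open>n\<close> once per period. There are \<open>m ^ (n - 1)\<close> such sequences, since they amount to a
  choice of one representative in \<open>{0..<m n}\<close> for each nonzero class modulo \<open>n\<close>.

  For \<open>d\<close> dividing \<open>n\<close>, the sequences fixed by the \<open>d\<close>-th power of the shift are exactly the
  sequences for \<open>d\<close> in place of \<open>n\<close> if \<open>n / d\<close> is coprime to \<open>m\<close>, and there are none otherwise.
  Rotation of words has the same numbers of fixed points, \<open>m ^ (d - 1)\<close> or \<open>0\<close>, and two
  finite sets with an action of a cyclic group of order \<open>n\<close> are equivariantly bijective as soon
  as these numbers agree.
\<close>

section \<open>Finite sets with a cyclic action\<close>

definition cyclic_on :: "nat \<Rightarrow> ('a \<Rightarrow> 'a) \<Rightarrow> 'a set \<Rightarrow> bool" where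
  "cyclic_on n \<sigma> S \<longleftrightarrow> \<sigma> ` S \<subseteq> S \<and> (\<forall>x\<in>S. (\<sigma> ^^ n) x = x)"

text \<open>The size of a smallest orbit: the minimum is taken over all points of \<open>S\<close>
  at once. Hence a point fixed by \<open>\<sigma> ^^ d\<close> has an orbit of exactly
  \<open>d\<close> elements, and no orbit is shorter.\<close>

definition minimal_period :: "('a \<Rightarrow> 'a) \<Rightarrow> 'a set \<Rightarrow> nat \<Rightarrow> bool" where
  "minimal_period \<sigma> S d \<longleftrightarrow> d > 0 \<and> (\<exists>x\<in>S. (\<sigma> ^^ d) x = x) \<and>
     (\<forall>e x. 0 < e \<and> e < d \<and> x \<in> S \<longrightarrow> (\<sigma> ^^ e) x \<noteq> x)"

lemma funpow_in:
  assumes "\<sigma> ` S \<subseteq> S" "x \<in> S"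
  shows "(\<sigma> ^^ i) x \<in> S"
  using assms by (induction i) auto

lemma minimal_period_exists:
  assumes "n > 0" "cyclic_on n \<sigma> S" "S \<noteq> {}"
  shows "\<exists>d. minimal_period \<sigma> S d"
proof -
  let ?P = "\<lambda>d. d > 0 \<and> (\<exists>x\<in>S. (\<sigma> ^^ d) x = x)"
  have "?P n" using assms by (auto simp: cyclic_on_def)
  then have "?P (LEAST d. ?P d)" by (rule LeastI)
  moreover have "\<not> ?P e" if "e < (LEAST d. ?P d)" for e
    using that by (rule not_less_Least)
  ultimately show ?thesis unfolding minimal_period_def by blast
qed

text \<open>If two of the first \<open>d\<close> iterates of \<open>x\<close> agreed, the difference
  of their exponents would be a positive exponent below \<open>d\<close> fixing an iterate of
  \<open>x\<close>, against minimality. All other exponents reduce modulo \<open>d\<close>.\<close>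

lemma funpow_eq_iff_cong:
  assumes S: "\<sigma> ` S \<subseteq> S" and x: "x \<in> S" "(\<sigma> ^^ d) x = x" and d: "minimal_period \<sigma> S d"
  shows "(\<sigma> ^^ i) x = (\<sigma> ^^ j) x \<longleftrightarrow> [i = j] (mod d)"
proof -
  have less: False if "a < b" "b < d" "(\<sigma> ^^ a) x = (\<sigma> ^^ b) x" for a b
  proof -
    have "(\<sigma> ^^ (b - a)) ((\<sigma> ^^ a) x) = (\<sigma> ^^ a) x"
      using that by (metis add.commute comp_apply funpow_add le_add_diff_inverse less_imp_le)
    moreover have "(\<sigma> ^^ a) x \<in> S" using S x(1) by (rule funpow_in)
    ultimately show False using d that unfolding minimal_period_def
      by (metis less_imp_diff_less zero_less_diff)
  qed
  have "d > 0" using d by (simp add: minimal_period_def)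
  then have "i mod d < d" "j mod d < d" by auto
  then have "(\<sigma> ^^ (i mod d)) x = (\<sigma> ^^ (j mod d)) x \<longleftrightarrow> i mod d = j mod d"
    using less[of "i mod d" "j mod d"] less[of "j mod d" "i mod d"] by (metis nat_neq_iff)
  then show ?thesis using funpow_mod_eq[OF x(2)] by (simp add: cong_def)
qed

lemma minimal_period_dvd:
  assumes "cyclic_on n \<sigma> S" "minimal_period \<sigma> S d"
  shows "d dvd n"
proof -
  obtain x where x: "x \<in> S" "(\<sigma> ^^ d) x = x" using assms(2) by (auto simp: minimal_period_def)
  have "(\<sigma> ^^ n) x = (\<sigma> ^^ 0) x" using assms(1) x(1) by (auto simp: cyclic_on_def)
  then have "[n = 0] (mod d)"
    using funpow_eq_iff_cong[OF _ x assms(2)] assms(1) unfolding cyclic_on_def by blast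
  then show ?thesis by (simp add: cong_0_iff)
qed

text \<open>On the removed orbit \<open>\<sigma> ^^ j\<close> fixes all \<open>d\<close> points or
  none, according to whether \<open>d\<close> divides \<open>j\<close>; so its contribution to the
  fixed point counts depends on \<open>d\<close> alone. The complement is invariant because
  \<open>\<sigma> ^^ (n - 1)\<close> inverts \<open>\<sigma>\<close> and leads from
  \<open>\<sigma> z\<close> back to \<open>z\<close>.\<close>

lemma remove_orbit:
  assumes "n > 0" "finite S" and cyc: "cyclic_on n \<sigma> S"
    and x: "x \<in> S" "(\<sigma> ^^ d) x = x" and d: "minimal_period \<sigma> S d"
    and Orb: "Orb = range (\<lambda>i. (\<sigma> ^^ i) x)"
  shows "Orb \<subseteq> S" "cyclic_on n \<sigma> (S - Orb)"
    "card {z\<in>S. (\<sigma> ^^ j) z = z} =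
       card {z\<in>S - Orb. (\<sigma> ^^ j) z = z} + (if d dvd j then d else 0)"
proof -
  have S: "\<sigma> ` S \<subseteq> S" using cyc by (simp add: cyclic_on_def)
  note eq = funpow_eq_iff_cong[OF S x d]
  show OS: "Orb \<subseteq> S" unfolding Orb using funpow_in[OF S x(1)] by auto
  have "z \<in> Orb" if "z \<in> S" "\<sigma> z \<in> Orb" for z
  proof -
    obtain i where i: "\<sigma> z = (\<sigma> ^^ i) x" using \<open>\<sigma> z \<in> Orb\<close> Orb by auto
    have "z = (\<sigma> ^^ n) z" using cyc \<open>z \<in> S\<close> by (simp add: cyclic_on_def)
    also have "\<dots> = (\<sigma> ^^ (n - 1)) (\<sigma> z)"
      using \<open>n > 0\<close> by (metis Suc_diff_1 comp_apply funpow_Suc_right)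
    also have "\<dots> = (\<sigma> ^^ (n - 1 + i)) x" unfolding i by (simp add: funpow_add)
    finally show ?thesis unfolding Orb by blast
  qed
  then show "cyclic_on n \<sigma> (S - Orb)" using cyc by (auto simp: cyclic_on_def)
  have d0: "d > 0" using d by (simp add: minimal_period_def)
  have "Orb = (\<lambda>i. (\<sigma> ^^ i) x) ` {..<d}"
  proof -
    have "(\<sigma> ^^ i) x \<in> (\<lambda>i. (\<sigma> ^^ i) x) ` {..<d}" for i
      using funpow_mod_eq[OF x(2), of i] d0 by (metis imageI lessThan_iff mod_less_divisor)
    then show ?thesis unfolding Orb by auto
  qed
  moreover have "inj_on (\<lambda>i. (\<sigma> ^^ i) x) {..<d}"
    by (rule inj_onI) (use eq in \<open>auto simp: cong_def\<close>)
  ultimately have cO: "card Orb = d" by (simp add: card_image)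
  have "(\<sigma> ^^ j) z = z \<longleftrightarrow> d dvd j" if "z \<in> Orb" for z
  proof -
    obtain i where i: "z = (\<sigma> ^^ i) x" using \<open>z \<in> Orb\<close> Orb by auto
    have "(\<sigma> ^^ j) z = (\<sigma> ^^ (j + i)) x" unfolding i by (simp add: funpow_add)
    then have "(\<sigma> ^^ j) z = z \<longleftrightarrow> [j + i = i] (mod d)" unfolding i by (simp add: eq)
    also have "\<dots> \<longleftrightarrow> d dvd j"
      by (simp add: cong_add_rcancel_0_nat cong_0_iff)
    finally show ?thesis .
  qed
  then have "{z\<in>S. (\<sigma> ^^ j) z = z} = {z\<in>S - Orb. (\<sigma> ^^ j) z = z} \<union> (if d dvd j then Orb else {})"
    using OS by auto
  moreover from OS have "finite Orb" using \<open>finite S\<close> by (rule finite_subset)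
  moreover have "card ({z\<in>S - Orb. (\<sigma> ^^ j) z = z} \<union> (if d dvd j then Orb else {})) =
      card {z\<in>S - Orb. (\<sigma> ^^ j) z = z} + card (if d dvd j then Orb else {})"
    using \<open>finite S\<close> \<open>finite Orb\<close> by (intro card_Un_disjoint) auto
  ultimately show "card {z\<in>S. (\<sigma> ^^ j) z = z} =
       card {z\<in>S - Orb. (\<sigma> ^^ j) z = z} + (if d dvd j then d else 0)"
    using cO by simp
qed

text \<open>Induction on the size of \<open>S\<close>: the counts show that both sets have smallest
  orbits of the same size. Matching one such orbit with another and removing both lowers all counts
  by equal amounts.\<close>

theorem equivariant_bijection_if_card_fixed_eq:
  assumes "n > 0" "finite S" "finite T" "cyclic_on n \<sigma> S" "cyclic_on n \<tau> T"
    and "\<And>d. d dvd n \<Longrightarrow> card {x\<in>S. (\<sigma> ^^ d) x = x} = card {y\<in>T. (\<tau> ^^ d) y = y}"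
  shows "\<exists>F. bij_betw F S T \<and> (\<forall>x\<in>S. F (\<sigma> x) = \<tau> (F x))"
  using assms(2-)
proof (induction "card S" arbitrary: S T rule: less_induct)
  case less
  note cyc = \<open>cyclic_on n \<sigma> S\<close> \<open>cyclic_on n \<tau> T\<close>
  have S: "\<sigma> ` S \<subseteq> S" and T: "\<tau> ` T \<subseteq> T" using cyc by (auto simp: cyclic_on_def)
  \<comment> \<open>The count for the divisor \<open>n\<close> itself is the cardinality of the
    whole set.\<close>
  have "{x\<in>S. (\<sigma> ^^ n) x = x} = S" "{y\<in>T. (\<tau> ^^ n) y = y} = T"
    using cyc by (auto simp: cyclic_on_def)
  then have card: "card S = card T" using less.prems(5)[of n] by simp
  show ?case
  proof (cases "S = {}")
    case True
    then show ?thesis using card less.prems(2) by (auto simp: bij_betw_def)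
  next
    case False
    then have "T \<noteq> {}" using card less.prems by auto
    obtain d where d: "minimal_period \<sigma> S d"
      using minimal_period_exists[OF \<open>n > 0\<close> cyc(1) False] ..
    obtain d' where d': "minimal_period \<tau> T d'"
      using minimal_period_exists[OF \<open>n > 0\<close> cyc(2) \<open>T \<noteq> {}\<close>] ..
    have ex: "(\<exists>x\<in>S. (\<sigma> ^^ e) x = x) \<longleftrightarrow> (\<exists>y\<in>T. (\<tau> ^^ e) y = y)" if "e dvd n" for e
    proof -
      have "(\<exists>x\<in>S. (\<sigma> ^^ e) x = x) \<longleftrightarrow> card {x\<in>S. (\<sigma> ^^ e) x = x} \<noteq> 0"
        using less.prems(1) by auto
      moreover have "(\<exists>y\<in>T. (\<tau> ^^ e) y = y) \<longleftrightarrow> card {y\<in>T. (\<tau> ^^ e) y = y} \<noteq> 0"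
        using less.prems(2) by auto
      ultimately show ?thesis using less.prems(5)[OF that] by simp
    qed
    \<comment> \<open>Both minimal periods divide \<open>n\<close>, so equal counts make each of
      them attained in the other set as well, and minimality excludes either being smaller.\<close>
    have "d = d'"
      using d d' ex[OF minimal_period_dvd[OF cyc(1) d]] ex[OF minimal_period_dvd[OF cyc(2) d']]
      unfolding minimal_period_def by (metis nat_neq_iff)
    with d' have d': "minimal_period \<tau> T d" by simp
    obtain x where x: "x \<in> S" "(\<sigma> ^^ d) x = x" using d by (auto simp: minimal_period_def)
    obtain y where y: "y \<in> T" "(\<tau> ^^ d) y = y" using d' by (auto simp: minimal_period_def)
    define O1 where "O1 = range (\<lambda>i. (\<sigma> ^^ i) x)"
    define O2 where "O2 = range (\<lambda>i. (\<tau> ^^ i) y)"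
    note r1 = remove_orbit[OF \<open>n > 0\<close> less.prems(1) cyc(1) x d O1_def]
    note r2 = remove_orbit[OF \<open>n > 0\<close> less.prems(2) cyc(2) y d' O2_def]
    have "x \<in> O1" unfolding O1_def by (metis funpow_0 rangeI)
    then have "card (S - O1) < card S"
      using less.prems(1) x(1) by (intro psubset_card_mono) auto
    moreover have "card {x \<in> S - O1. (\<sigma> ^^ e) x = x} = card {y \<in> T - O2. (\<tau> ^^ e) y = y}"
      if "e dvd n" for e
      using less.prems(5)[OF that] r1(3)[of e] r2(3)[of e] by simp
    ultimately obtain F where F: "bij_betw F (S - O1) (T - O2)"
        "\<And>z. z \<in> S - O1 \<Longrightarrow> F (\<sigma> z) = \<tau> (F z)"
      using less.hyps[of "S - O1" "T - O2"] r1(2) r2(2) less.prems(1,2) by auto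
    \<comment> \<open>The exponent is chosen arbitrarily; the choice is harmless because exponents
      naming the same point of either orbit are exactly those congruent modulo
      \<open>d\<close>.\<close>
    define G where "G z = (\<tau> ^^ (SOME i. z = (\<sigma> ^^ i) x)) y" for z
    have G: "G ((\<sigma> ^^ i) x) = (\<tau> ^^ i) y" for i
    proof -
      have "(\<sigma> ^^ i) x = (\<sigma> ^^ (SOME j. (\<sigma> ^^ i) x = (\<sigma> ^^ j) x)) x" by (rule someI) simp
      then show ?thesis
        unfolding G_def funpow_eq_iff_cong[OF S x d] funpow_eq_iff_cong[OF T y d']
        by (rule cong_sym)
    qed
    have bG: "bij_betw G O1 O2"
      unfolding bij_betw_def
    proof
      show "inj_on G O1"
        by (rule inj_onI)
          (auto simp: O1_def G funpow_eq_iff_cong[OF S x d] funpow_eq_iff_cong[OF T y d'])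
      show "G ` O1 = O2" by (auto simp: O1_def O2_def G image_image)
    qed
    let ?H = "\<lambda>z. if z \<in> O1 then G z else F z"
    have "bij_betw ?H O1 O2" using bG by (subst bij_betw_cong[of _ _ G]) auto
    moreover have "bij_betw ?H (S - O1) (T - O2)" using F(1) by (subst bij_betw_cong[of _ _ F]) auto
    ultimately have "bij_betw ?H (O1 \<union> (S - O1)) (O2 \<union> (T - O2))"
      by (rule bij_betw_combine) auto
    then have "bij_betw ?H S T" using r1(1) r2(1) by (simp add: Un_absorb1)
    moreover have "?H (\<sigma> z) = \<tau> (?H z)" if z: "z \<in> S" for z
    proof (cases "z \<in> O1")
      case True
      then obtain i where i: "z = (\<sigma> ^^ i) x" by (auto simp: O1_def)
      have "\<sigma> z = (\<sigma> ^^ Suc i) x" by (simp add: i)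
      moreover from this have "\<sigma> z \<in> O1" unfolding O1_def by (rule range_eqI)
      ultimately show ?thesis using True G[of "Suc i"] G[of i] by (simp add: i)
    next
      case False
      then have "\<sigma> z \<notin> O1" using r1(2) z by (auto simp: cyclic_on_def)
      then show ?thesis using False F(2) z by simp
    qed
    ultimately show ?thesis by blast
  qed
qed

section \<open>Rotation of words\<close>

definition shift :: "(nat \<Rightarrow> 'a) \<Rightarrow> nat \<Rightarrow> 'a" where
  "shift w i = w (Suc i)"

text \<open>Words as periodic functions on all indices: rotation becomes an index shift without
  wrap-around, and being fixed by a power of it is simply having a shorter period.\<close>

definition periodic_words :: "nat \<Rightarrow> nat \<Rightarrow> (nat \<Rightarrow> nat) set" where
  "periodic_words n m =
     {w. (\<forall>i. w (i + n) = w i) \<and> (\<forall>i. w i < m) \<and> [(\<Sum>i<n. w i) = m - 1] (mod m)}"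

lemma funpow_shift: "(shift ^^ d) w = (\<lambda>i. w (i + d))"
  by (induction d) (auto simp: shift_def)

lemma periodic_add_mult:
  fixes w :: "nat \<Rightarrow> 'a"
  assumes "\<And>i. w (i + d) = w i"
  shows "w (i + e * d) = w i"
proof (induction e)
  case (Suc e)
  have "w (i + Suc e * d) = w ((i + e * d) + d)" by (simp add: algebra_simps)
  then show ?case using Suc assms by simp
qed simp

lemma periodic_mod:
  fixes w :: "nat \<Rightarrow> 'a"
  assumes "\<And>i. w (i + d) = w i"
  shows "w (i mod d) = w i"
  using periodic_add_mult[of w d "i mod d" "i div d", OF assms] by simp

lemma sum_lessThan_add: "(\<Sum>i<a + b. f i) = (\<Sum>i<a. f i) + (\<Sum>i<b. f (a + i :: nat))"
  for f :: "nat \<Rightarrow> 'a::comm_monoid_add"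
  by (induction b) (auto simp: add.assoc)

lemma sum_periodic:
  fixes w :: "nat \<Rightarrow> nat"
  assumes "\<And>i. w (i + d) = w i"
  shows "(\<Sum>i<e * d. w i) = e * (\<Sum>i<d. w i)"
proof (induction e)
  case (Suc e)
  have "(\<Sum>i<Suc e * d. w i) = (\<Sum>i<e * d + d. w i)" by (simp add: add.commute)
  also have "\<dots> = (\<Sum>i<e * d. w i) + (\<Sum>i<d. w (e * d + i))" by (rule sum_lessThan_add)
  also have "(\<Sum>i<d. w (e * d + i)) = (\<Sum>i<d. w i)"
    using periodic_add_mult[of w d _ e, OF assms] by (simp add: add.commute)
  finally show ?case using Suc by simp
qed simp

text \<open>The condition \<open>Q\<close> on the sum stays abstract, since the lemma serves both
  for words of full length and for one period of a word fixed by a power of the rotation, where the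
  condition on the sum is different.\<close>

lemma bij_betw_periodic_lists:
  assumes "d > 0"
  shows "bij_betw (\<lambda>w. map w [0..<d])
           {w. (\<forall>i. w (i + d) = w i) \<and> (\<forall>i. w i < m) \<and> Q (\<Sum>i<d. w i)}
           {xs. length xs = d \<and> set xs \<subseteq> {..<m::nat} \<and> Q (sum_list xs)}"
    (is "bij_betw _ ?W ?L")
proof (rule bij_betwI[where g = "\<lambda>xs i. xs ! (i mod d)"])
  have sl: "sum_list (map w [0..<d]) = (\<Sum>i<d. w i)" for w :: "nat \<Rightarrow> nat"
    by (simp add: interv_sum_list_conv_sum_set_nat atLeast0LessThan)
  show "(\<lambda>w. map w [0..<d]) \<in> ?W \<rightarrow> ?L" by (auto simp: sl)
  show "(\<lambda>i. map w [0..<d] ! (i mod d)) = w" if "w \<in> ?W" for w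
    using that periodic_mod[of w d] assms by auto
  show eq: "map (\<lambda>i. xs ! (i mod d)) [0..<d] = xs" if "xs \<in> ?L" for xs
    using that by (auto intro!: nth_equalityI)
  show "(\<lambda>xs i. xs ! (i mod d)) \<in> ?L \<rightarrow> ?W"
  proof
    fix xs assume xs: "xs \<in> ?L"
    have "xs ! (i mod d) < m" for i
      using xs assms by (metis (mono_tags, lifting) lessThan_iff mem_Collect_eq mod_less_divisor nth_mem subsetD)
    moreover have "(\<Sum>i<d. xs ! (i mod d)) = sum_list xs"
      using eq[OF xs] sl[of "\<lambda>i. xs ! (i mod d)"] by simp
    ultimately show "(\<lambda>i. xs ! (i mod d)) \<in> ?W" using xs by simp
  qed
qed

lemma bij_betw_words:
  "bij_betw (\<lambda>w. map w [0..<k + 1]) (periodic_words (k + 1) m) (words k m)"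
  unfolding periodic_words_def words_def by (rule bij_betw_periodic_lists) simp

lemma map_shift_upt:
  assumes "d > 0" "w (0 + d) = w 0"
  shows "map (shift w) [0..<d] = rotate1 (map w [0..<d])"
proof (rule nth_equalityI)
  fix i assume "i < length (map (shift w) [0..<d])"
  then show "map (shift w) [0..<d] ! i = rotate1 (map w [0..<d]) ! i"
    using assms by (cases "Suc i = d") (auto simp: nth_rotate1 shift_def)
qed simp


section \<open>Counting words fixed by powers of the rotation\<close>

text \<open>The first letter is forced modulo \<open>m\<close> by the others, which are
  free.\<close>

lemma card_lists_sum_cong:
  assumes "m > 0"
  shows "card {xs. length xs = Suc d \<and> set xs \<subseteq> {..<m} \<and> [sum_list xs = u] (mod m)} = m ^ d"
    (is "card ?L = _")
proof -
  let ?R = "{ys. set ys \<subseteq> {..<m} \<and> length ys = d}"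
  have "bij_betw tl ?L ?R"
    unfolding bij_betw_def
  proof
    show "inj_on tl ?L"
    proof (rule inj_onI)
      fix xs ys assume xy: "xs \<in> ?L" "ys \<in> ?L" "tl xs = tl ys"
      then obtain a b zs where ab: "xs = a # zs" "ys = b # zs"
        by (cases xs; cases ys) auto
      then have "[a + sum_list zs = b + sum_list zs] (mod m)"
        using xy by (auto simp: cong_def)
      then have "[a = b] (mod m)" by (simp add: cong_add_rcancel_nat)
      then show "xs = ys" using xy ab by (simp add: cong_def)
    qed
    show "tl ` ?L = ?R"
    proof
      show "tl ` ?L \<subseteq> ?R" by (force simp: length_Suc_conv)
      show "?R \<subseteq> tl ` ?L"
      proof
        fix ys assume ys: "ys \<in> ?R"
        \<comment> \<open>Multiplying by \<open>m - 1\<close> stands for negation modulo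
          \<open>m\<close>, avoiding subtraction of naturals.\<close>
        let ?a = "(u + (m - 1) * sum_list ys) mod m"
        have "[?a + sum_list ys = u + (m - 1) * sum_list ys + sum_list ys] (mod m)"
          by (simp add: cong_def mod_add_left_eq)
        also have "u + (m - 1) * sum_list ys + sum_list ys = u + m * sum_list ys"
          using assms by (cases m) auto
        also have "[u + m * sum_list ys = u] (mod m)" by (simp add: cong_def)
        finally have "?a # ys \<in> ?L" using ys assms by simp
        then show "ys \<in> tl ` ?L" by (rule rev_image_eqI) simp
      qed
    qed
  qed
  then have "card ?L = card ?R" by (rule bij_betw_same_card)
  then show ?thesis by (simp add: card_lists_length_eq)
qed

text \<open>As \<open>m - 1\<close> is -1 modulo \<open>m\<close>, a solution \<open>s\<close>
  exhibits \<open>e\<close> as a unit modulo \<open>m\<close>; conversely a unit can be cancelled,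
  which determines \<open>s\<close> modulo \<open>m\<close>.\<close>

lemma cong_scaled_iff:
  fixes e m :: nat
  assumes "m > 0"
  shows "coprime e m \<Longrightarrow> \<exists>u. \<forall>s. [e * s = m - 1] (mod m) \<longleftrightarrow> [s = u] (mod m)"
    and "\<not> coprime e m \<Longrightarrow> \<not> [e * s = m - 1] (mod m)"
proof -
  assume "coprime e m"
  then obtain x where "[e * x = Suc 0] (mod m)" using cong_solve_coprime_nat by blast
  then have "[e * (x * (m - 1)) = m - 1] (mod m)"
    using cong_scalar_right[of "e * x" "Suc 0" m "m - 1"] by (simp add: mult.assoc)
  then have "[e * s = m - 1] (mod m) \<longleftrightarrow> [e * s = e * (x * (m - 1))] (mod m)" for s
    by (meson cong_sym cong_trans)
  then have "[e * s = m - 1] (mod m) \<longleftrightarrow> [s = x * (m - 1)] (mod m)" for s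
    using \<open>coprime e m\<close> by (simp add: cong_mult_lcancel_nat)
  then show "\<exists>u. \<forall>s. [e * s = m - 1] (mod m) \<longleftrightarrow> [s = u] (mod m)" by blast
next
  assume nc: "\<not> coprime e m"
  show "\<not> [e * s = m - 1] (mod m)"
  proof
    assume "[e * s = m - 1] (mod m)"
    then have "[e * s + 1 = m - 1 + 1] (mod m)" by (rule cong_add) simp
    then have "m dvd e * s + 1" using assms by (simp add: cong_def mod_eq_0_iff_dvd)
    then have "coprime e m"
      by (meson coprime_common_divisor_nat coprimeI dvd_add_right_iff dvd_mult2 dvd_trans)
    with nc show False ..
  qed
qed

text \<open>A fixed word has period \<open>d\<close>, so its sum over \<open>n\<close> letters is
  \<open>n div d\<close> times the sum over one period. The sum condition thus becomes a congruence
  that pins down the sum over one period or has no solution.\<close>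

lemma card_periodic_words_fixed:
  assumes "m > 0" "n > 0" "d dvd n"
  shows "card {w \<in> periodic_words n m. (shift ^^ d) w = w} =
           (if coprime (n div d) m then m ^ (d - 1) else 0)"
proof -
  define e where "e = n div d"
  have n: "n = e * d" and d: "d > 0" using assms by (auto simp: e_def intro: Nat.gr0I)
  let ?S = "{w \<in> periodic_words n m. (shift ^^ d) w = w}"
  have S: "?S = {w. (\<forall>i. w (i + d) = w i) \<and> (\<forall>i. w i < m) \<and>
      [e * (\<Sum>i<d. w i) = m - 1] (mod m)}" (is "_ = ?S'")
  proof -
    have "w \<in> ?S \<longleftrightarrow> w \<in> ?S'" for w
    proof (cases "\<forall>i. w (i + d) = w i")
      case True
      then show ?thesis
        using periodic_add_mult[of w d] sum_periodic[of w d e]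
        by (auto simp: periodic_words_def funpow_shift n)
    next
      case False
      then show ?thesis by (auto simp: funpow_shift dest: fun_cong)
    qed
    then show ?thesis by blast
  qed
  show ?thesis
  proof (cases "coprime e m")
    case True
    then obtain u where u: "\<And>s. [e * s = m - 1] (mod m) \<longleftrightarrow> [s = u] (mod m)"
      using cong_scaled_iff(1)[OF \<open>m > 0\<close>] by blast
    let ?L = "{xs. length xs = Suc (d - 1) \<and> set xs \<subseteq> {..<m} \<and> [sum_list xs = u] (mod m)}"
    have "bij_betw (\<lambda>w. map w [0..<d]) ?S' ?L"
      unfolding u Suc_diff_1[OF d] using d by (rule bij_betw_periodic_lists)
    then have "card ?S' = card ?L" by (rule bij_betw_same_card)
    then show ?thesis using True S card_lists_sum_cong[OF \<open>m > 0\<close>, of "d - 1" u] by (simp add: e_def)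
  next
    case False
    then have "?S' = {}" using cong_scaled_iff(2)[OF \<open>m > 0\<close> False] by blast
    then have "card ?S = 0" unfolding S by (simp only: card.empty)
    then show ?thesis using False by (simp add: e_def)
  qed
qed

lemma cyclic_on_periodic_words: "cyclic_on n shift (periodic_words n m)"
proof -
  have "shift w \<in> periodic_words n m" if "w \<in> periodic_words n m" for w
  proof -
    have "(\<Sum>i<n. shift w i) + w 0 = (\<Sum>i<n. w i) + w n"
      using sum.lessThan_Suc[of w n] sum.lessThan_Suc_shift[of w n] by (simp add: shift_def)
    moreover have "w n = w 0" using that by (metis (mono_tags, lifting) add_0 mem_Collect_eq periodic_words_def)
    ultimately show ?thesis using that by (simp add: periodic_words_def shift_def flip: add_Suc)
  qed
  then show ?thesis by (auto simp: cyclic_on_def funpow_shift periodic_words_def)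
qed

text \<open>The case \<open>d = n\<close> of the fixed point count covers all words, and its value
  is positive, whereas infinite sets have cardinality 0.\<close>

lemma finite_periodic_words:
  assumes "m > 0" "n > 0"
  shows "finite (periodic_words n m)"
proof -
  have "{w \<in> periodic_words n m. (shift ^^ n) w = w} = periodic_words n m"
    using cyclic_on_periodic_words by (auto simp: cyclic_on_def)
  then show ?thesis
    using card_periodic_words_fixed[OF assms dvd_refl] assms by (auto intro: card_ge_0_finite)
qed

section \<open>Integer sequences meeting every residue class\<close>

text \<open>An index shift followed by the translation that restores the value 0 at index 0.\<close>

definition advance :: "(nat \<Rightarrow> 'a::ab_group_add) \<Rightarrow> nat \<Rightarrow> 'a" where
  "advance P i = P (Suc i) - P 1"

lemma funpow_advance:
  assumes "P 0 = 0"
  shows "(advance ^^ d) P = (\<lambda>i. P (i + d) - P d)"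
  using assms by (induction d) (auto simp: advance_def)

text \<open>By quasi-periodicity \<open>P\<close> acts on index classes modulo \<open>n\<close>; the
  last clause makes this action injective, hence a permutation of the residues.\<close>

definition center_seqs :: "nat \<Rightarrow> nat \<Rightarrow> (nat \<Rightarrow> int) set" where
  "center_seqs n m = {P. P 0 = 0 \<and> strict_mono P \<and> (\<forall>i. P (i + n) = P i + int (m * n)) \<and>
     (\<forall>i j. [P i = P j] (mod int n) \<longrightarrow> [i = j] (mod n))}"

lemma quasi_periodic_add_mult:
  fixes P :: "nat \<Rightarrow> 'a::comm_semiring_1"
  assumes "\<And>i. P (i + d) = P i + c"
  shows "P (i + e * d) = P i + of_nat e * c"
proof (induction e)
  case (Suc e)
  have "P (i + Suc e * d) = P ((i + e * d) + d)" by (simp add: algebra_simps)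
  also have "\<dots> = P (i + e * d) + c" by (rule assms)
  finally show ?case using Suc by (simp add: algebra_simps)
qed simp

lemma quasi_periodic_mod:
  fixes P :: "nat \<Rightarrow> 'a::comm_semiring_1"
  assumes "\<And>i. P (i + d) = P i + c"
  shows "P i = P (i mod d) + of_nat (i div d) * c"
  using quasi_periodic_add_mult[of P d c "i mod d" "i div d", OF assms] by simp

lemma cyclic_on_center_seqs: "cyclic_on n advance (center_seqs n m)"
proof -
  have "advance P \<in> center_seqs n m" if P: "P \<in> center_seqs n m" for P
  proof -
    have "[i = j] (mod n)" if "[P (Suc i) - P 1 = P (Suc j) - P 1] (mod int n)" for i j
    proof -
      have "[P (Suc i) = P (Suc j)] (mod int n)"
        using cong_add[OF that cong_refl[of "P 1"]] by simp
      then have "[1 + i = 1 + j] (mod n)" using P by (simp add: center_seqs_def)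
      then show ?thesis by (simp only: cong_add_lcancel_nat)
    qed
    then show ?thesis using P by (simp add: center_seqs_def advance_def strict_mono_def flip: add_Suc)
  qed
  moreover have "(advance ^^ n) P = P" if "P \<in> center_seqs n m" for P
  proof -
    have "P (0 + n) = P 0 + int (m * n)" "P 0 = 0" using that unfolding center_seqs_def by blast+
    then show ?thesis using that by (simp add: funpow_advance center_seqs_def)
  qed
  ultimately show ?thesis by (auto simp: cyclic_on_def)
qed

text \<open>Being fixed means \<open>P (i + d) = P i + P d\<close>, and the growth
  \<open>m * n\<close> over \<open>n = e * d\<close> indices forces \<open>P d = m * d\<close>.
  Moving by \<open>t\<close> such blocks adds \<open>t * m * d\<close>, and these shifts are
  distinct modulo \<open>n\<close> for distinct \<open>t\<close> modulo \<open>e\<close> exactly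
  when \<open>e\<close> is coprime to \<open>m\<close>. In that case injectivity modulo
  \<open>n\<close> and modulo \<open>d\<close> are equivalent.\<close>

lemma center_seqs_fixed_iff:
  assumes "n > 0" "n = e * d"
  shows "P \<in> center_seqs n m \<and> (advance ^^ d) P = P \<longleftrightarrow> coprime e m \<and> P \<in> center_seqs d m"
proof
  assume P: "P \<in> center_seqs n m \<and> (advance ^^ d) P = P"
  have e: "e > 0" "d > 0" using assms by (auto intro: Nat.gr0I)
  have P0: "P 0 = 0" and per_n: "P (i + n) = P i + int (m * n)"
    and inj: "[P i = P j] (mod int n) \<Longrightarrow> [i = j] (mod n)" for i j
    using P by (auto simp: center_seqs_def)
  have per: "P (i + d) = P i + P d" for i
    using P P0 by (auto simp: funpow_advance dest: fun_cong[of _ _ i])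
  have "P n = int e * P d"
    using quasi_periodic_add_mult[of P d "P d" 0 e, OF per] P0 assms(2) by simp
  moreover have "P n = int (m * n)" using per_n[of 0] P0 by simp
  ultimately have Pd: "P d = int (m * d)" using e assms(2) by simp
  have mult: "P (i + t * d) = P i + int (t * m * d)" for i t
    using quasi_periodic_add_mult[of P d "P d" i t, OF per] Pd by simp
  have co: "coprime e m"
  proof -
    \<comment> \<open>With \<open>g = gcd e m\<close>, already \<open>e div g\<close> blocks add a
      multiple of \<open>n\<close>, so injectivity makes \<open>e\<close> divide
      \<open>e div g\<close>.\<close>
    define g where "g = gcd e m"
    obtain e' m' where g: "e = g * e'" "m = g * m'" by (metis g_def gcd_dvd1 gcd_dvd2 dvd_def)
    have "P (0 + e' * d) = int (m' * n)" unfolding mult using P0 g assms(2) by simp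
    then have "[P (e' * d) = P 0] (mod int n)" using P0 by (simp add: cong_def)
    then have "[e' * d = 0] (mod n)" by (rule inj)
    then have "e dvd e'" using e assms(2) by (simp add: cong_0_iff)
    then have "e \<le> e'" using e g by (auto intro: dvd_imp_le Nat.gr0I)
    then have "g = 1" using g e by (metis One_nat_def Suc_leI dual_order.antisym less_eq_nat.simps(1) mult_is_0 mult_le_cancel2 nat_0_less_mult_iff nat_mult_1 neq0_conv)
    then show ?thesis by (simp add: g_def coprime_iff_gcd_eq_1)
  qed
  moreover have "[i = j] (mod d)" if ij: "[P i = P j] (mod int d)" for i j
  proof -
    obtain q where q: "P j = P i + int d * q"
      using ij by (metis cong_iff_lin cong_sym)
    \<comment> \<open>An inverse of \<open>m\<close> modulo \<open>e\<close> yields a number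
      \<open>t\<close> of blocks with \<open>m * t\<close> congruent to \<open>q\<close> modulo
      \<open>e\<close>. Moving \<open>i\<close> by these blocks turns the congruence modulo
      \<open>d\<close> into one modulo \<open>n\<close>.\<close>
    obtain x where x: "[int m * x = 1] (mod int e)"
      using cong_solve_coprime_int[of "int m" "int e"] co by (auto simp: coprime_commute)
    define t where "t = nat ((x * q) mod int e)"
    have "[int t = x * q] (mod int e)" using e by (simp add: t_def cong_def)
    then have "[int m * int t = int m * (x * q)] (mod int e)" by (rule cong_scalar_left)
    also have "int m * (x * q) = (int m * x) * q" by simp
    also have "[(int m * x) * q = 1 * q] (mod int e)" using x by (rule cong_scalar_right)
    finally have "[int m * int t = q] (mod int e)" by simp
    then have "int e dvd int m * int t - q" by (simp add: cong_iff_dvd_diff)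
    then have "int e * int d dvd (int m * int t - q) * int d" by (rule mult_dvd_mono) simp
    moreover have "P (i + t * d) - P j = (int m * int t - q) * int d"
      unfolding mult q by (simp add: algebra_simps)
    ultimately have "[P (i + t * d) = P j] (mod int n)"
      unfolding cong_iff_dvd_diff assms(2) by simp
    then have "[i + t * d = j] (mod n)" by (rule inj)
    then have "[i + t * d = j] (mod d)" using assms(2) by (auto intro: cong_dvd_modulus_nat)
    then show ?thesis by (simp add: cong_def)
  qed
  ultimately show "coprime e m \<and> P \<in> center_seqs d m"
    using P per Pd by (simp add: center_seqs_def)
next
  assume P: "coprime e m \<and> P \<in> center_seqs d m"
  have e: "e > 0" "d > 0" using assms by (auto intro: Nat.gr0I)
  have P0: "P 0 = 0" and per: "P (i + d) = P i + int (m * d)"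
    and inj: "[P i = P j] (mod int d) \<Longrightarrow> [i = j] (mod d)" for i j
    using P by (auto simp: center_seqs_def)
  have mult: "P (i + t * d) = P i + int t * int (m * d)" for i t
    using quasi_periodic_add_mult[of P d "int (m * d)" i t, OF per] by simp
  \<comment> \<open>For \<open>i \<le> j\<close> the index difference is a natural multiple of
    \<open>d\<close>, as \<open>mult\<close> requires; the other case is symmetric.\<close>
  have le: "[i = j] (mod n)" if ij: "[P i = P j] (mod int n)" "i \<le> j" for i j
  proof -
    have "[P i = P j] (mod int d)" using ij(1) assms(2) by (auto intro: cong_dvd_modulus)
    then have "[j = i] (mod d)" using inj cong_sym by blast
    then obtain t where t: "j = i + t * d"
      using ij(2) cong_le_nat[of i j d] by (auto simp: add.commute)
    have "int n dvd P j - P i" using ij(1) by (metis cong_iff_dvd_diff cong_sym)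
    then have "int (e * d) dvd int (t * m * d)" using mult[of i t] t assms(2) by (simp add: mult.assoc)
    then have "e dvd t * m" using e by (simp only: int_dvd_int_iff dvd_times_right_cancel_iff)
    then have "e dvd t" using P by (simp add: coprime_dvd_mult_left_iff)
    then have "n dvd t * d" using assms(2) by simp
    then show ?thesis using t by (metis cong_add_lcancel_0_nat cong_0_iff cong_sym)
  qed
  have "[i = j] (mod n)" if "[P i = P j] (mod int n)" for i j
    using le[of i j] le[of j i] that by (metis cong_sym nat_le_linear)
  moreover have "P (i + n) = P i + int (m * n)" for i using mult[of i e] assms(2) by simp
  moreover have "(advance ^^ d) P = P" using per[of 0] per P0 by (simp add: funpow_advance)
  ultimately show "P \<in> center_seqs n m \<and> (advance ^^ d) P = P"
    using P by (simp add: center_seqs_def)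
qed

section \<open>Counting center sequences\<close>

definition residue_sections :: "nat \<Rightarrow> nat \<Rightarrow> int set set" where
  "residue_sections n m = {X. X \<subseteq> {0..<int (m * n)} \<and> 0 \<in> X \<and>
     bij_betw (\<lambda>x. x mod int n) X {0..<int n}}"

text \<open>A strictly increasing sequence is recovered from its values on one period by sorting
  them, and quasi-periodicity then gives the rest.\<close>

lemma bij_betw_center_seqs:
  assumes "n > 0"
  shows "bij_betw (\<lambda>P. P ` {..<n}) (center_seqs n m) (residue_sections n m)"
  unfolding bij_betw_def
proof
  show "inj_on (\<lambda>P. P ` {..<n}) (center_seqs n m)"
  proof (rule inj_onI)
    fix P Q assume PQ: "P \<in> center_seqs n m" "Q \<in> center_seqs n m" "P ` {..<n} = Q ` {..<n}"
    have "sorted_wrt (<) (map R [0..<n])" if "R \<in> center_seqs n m" for R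
      using that by (auto simp: sorted_wrt_iff_nth_less center_seqs_def strict_mono_def)
    moreover have "set (map P [0..<n]) = set (map Q [0..<n])" using PQ(3) by (simp add: atLeast0LessThan)
    ultimately have "map P [0..<n] = map Q [0..<n]" using PQ strict_sorted_equal by blast
    then have "P i = Q i" if "i < n" for i using that by simp
    moreover have "R i = R (i mod n) + int (i div n) * int (m * n)" if "R \<in> center_seqs n m" for R i
      using that by (intro quasi_periodic_mod) (simp add: center_seqs_def)
    ultimately show "P = Q" using PQ assms by (metis ext mod_less_divisor)
  qed
  show "(\<lambda>P. P ` {..<n}) ` center_seqs n m = residue_sections n m"
  proof
    show "(\<lambda>P. P ` {..<n}) ` center_seqs n m \<subseteq> residue_sections n m"
    proof (rule image_subsetI)
      fix P assume P: "P \<in> center_seqs n m"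
      then have mono: "strict_mono P" and P0: "P 0 = 0" and Pn: "P n = int (m * n)"
        unfolding center_seqs_def by (auto dest: spec[of _ 0])
      have "inj_on (\<lambda>i. P i mod int n) {..<n}"
        using P by (auto intro!: inj_onI simp: center_seqs_def cong_def) (metis mod_less)
      then have inj: "inj_on (\<lambda>x. x mod int n) (P ` {..<n})" and "card ((\<lambda>i. P i mod int n) ` {..<n}) = n"
        by (auto simp: inj_on_def card_image)
      moreover have "(\<lambda>i. P i mod int n) ` {..<n} \<subseteq> {0..<int n}" using assms by auto
      ultimately have "(\<lambda>i. P i mod int n) ` {..<n} = {0..<int n}"
        by (intro card_subset_eq) auto
      then have "bij_betw (\<lambda>x. x mod int n) (P ` {..<n}) {0..<int n}"
        using inj by (simp add: bij_betw_def image_image)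
      moreover have "P ` {..<n} \<subseteq> {0..<int (m * n)}"
      proof (rule image_subsetI)
        fix i assume "i \<in> {..<n}"
        then have "P 0 \<le> P i" "P i < P n" using mono by (auto simp: strict_mono_less strict_mono_less_eq)
        then show "P i \<in> {0..<int (m * n)}" using P0 Pn by simp
      qed
      moreover have "0 \<in> P ` {..<n}" using P0 assms by force
      ultimately show "P ` {..<n} \<in> residue_sections n m" by (simp add: residue_sections_def)
    qed
    show "residue_sections n m \<subseteq> (\<lambda>P. P ` {..<n}) ` center_seqs n m"
    proof
      fix X assume X: "X \<in> residue_sections n m"
      then have sub: "X \<subseteq> {0..<int (m * n)}" and X0: "0 \<in> X"
        and bij: "bij_betw (\<lambda>x. x mod int n) X {0..<int n}"
        by (auto simp: residue_sections_def)
      have fin: "finite X" using sub by (rule finite_subset) simp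
      define xs where "xs = sorted_list_of_set X"
      have set: "set xs = X" and dist: "distinct xs" and sorted: "sorted_wrt (<) xs"
        using fin by (auto simp: xs_def)
      have len: "length xs = n"
        using bij_betw_same_card[OF bij] distinct_card[OF dist] set by simp
      define P where "P i = xs ! (i mod n) + int (i div n) * int (m * n)" for i
      have mem: "xs ! (i mod n) \<in> X" for i using assms len set by (metis mod_less_divisor nth_mem)
      have "P i < P (Suc i)" for i
      proof (cases "Suc (i mod n) = n")
        case True
        then have s: "Suc i mod n = 0" "Suc i div n = Suc (i div n)"
          by (auto simp: mod_Suc div_Suc)
        \<comment> \<open>At the end of a period the increase comes from the bound
          \<open>m * n\<close> on the elements of \<open>X\<close>: the next period starts at
          \<open>m * n\<close> or higher, relative to the current one.\<close>
        have "xs ! (i mod n) < int (m * n)" "0 \<le> xs ! 0"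
          using mem[of i] mem[of 0] sub by auto
        then show ?thesis unfolding P_def s by (simp add: algebra_simps)
      next
        case False
        then have s: "Suc i mod n = Suc (i mod n)" "Suc i div n = i div n"
          by (auto simp: mod_Suc div_Suc)
        have "Suc (i mod n) < n" using False assms by (metis Suc_lessI mod_less_divisor)
        then show ?thesis unfolding P_def s
          using sorted len by (simp add: sorted_wrt_iff_nth_less)
      qed
      then have "strict_mono P" by (simp add: strict_mono_Suc_iff)
      moreover have "P 0 = 0"
      proof -
        obtain j where j: "j < n" "xs ! j = 0" using X0 set len by (metis in_set_conv_nth)
        then have "xs ! 0 \<le> 0"
          using sorted len sorted_wrt_nth_less[OF sorted, of 0 j] by (cases "j = 0") auto
        moreover have "xs ! 0 \<in> X" using mem[of 0] by simp
        ultimately show ?thesis using sub by (auto simp: P_def)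
      qed
      moreover have "P (i + n) = P i + int (m * n)" for i
        using assms by (simp add: P_def algebra_simps)
      moreover have "[i = j] (mod n)" if "[P i = P j] (mod int n)" for i j
      proof -
        have "[P l = xs ! (l mod n)] (mod int n)" for l by (simp add: P_def cong_def mult.assoc[symmetric])
        then have "[xs ! (i mod n) = xs ! (j mod n)] (mod int n)"
          using that by (meson cong_sym cong_trans)
        then have "xs ! (i mod n) = xs ! (j mod n)"
          using inj_onD[OF bij_betw_imp_inj_on[OF bij]] mem by (simp add: cong_def)
        then show ?thesis using dist len assms by (simp add: nth_eq_iff_index_eq cong_def)
      qed
      ultimately have "P \<in> center_seqs n m" by (simp add: center_seqs_def)
      moreover have "P ` {..<n} = X"
        using set len by (auto simp: P_def set_conv_nth image_iff)
      ultimately show "X \<in> (\<lambda>P. P ` {..<n}) ` center_seqs n m" by blast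
    qed
  qed
qed

text \<open>The representative of class \<open>r\<close> is \<open>r + n * f r\<close> with
  \<open>f r\<close> any of \<open>m\<close> values, except that class 0 is represented by 0. A
  section is thus a free choice of \<open>f\<close> on the \<open>n - 1\<close> nonzero
  classes.\<close>

lemma card_residue_sections:
  assumes "n > 0" "m > 0"
  shows "card (residue_sections n m) = m ^ (n - 1)"
proof -
  \<comment> \<open>The value of \<open>f\<close> at 0 is ignored because 0 is prescribed; the
    inverse \<open>g\<close> is restricted to the nonzero classes to be extensional.\<close>
  define h where "h f r = r + int n * (if r = 0 then 0 else f r)" for f and r :: int
  define g where "g X = restrict (\<lambda>r. inv_into X (\<lambda>x. x mod int n) r div int n) {1..<int n}"
    for X :: "int set"
  let ?F = "{1..<int n} \<rightarrow>\<^sub>E {0..<int m}"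
  have hmod: "h f r mod int n = r" if "r \<in> {0..<int n}" for f r
    using that by (simp add: h_def)
  have bij: "bij_betw (\<lambda>x. x mod int n) (h f ` {0..<int n}) {0..<int n}" for f
    by (rule bij_betw_byWitness[where f' = "h f"]) (use assms in \<open>auto simp: hmod\<close>)
  have "bij_betw (\<lambda>f. h f ` {0..<int n}) ?F (residue_sections n m)"
  proof (rule bij_betwI[where g = g])
    show "(\<lambda>f. h f ` {0..<int n}) \<in> ?F \<rightarrow> residue_sections n m"
    proof
      fix f assume f: "f \<in> ?F"
      have "h f r \<in> {0..<int (m * n)}" if r: "r \<in> {0..<int n}" for r
      proof (cases "r = 0")
        case False
        then have fr: "f r \<in> {0..<int m}" using f r by (auto simp: PiE_iff)
        then have "int n * f r \<le> int n * (int m - 1)" by (intro mult_left_mono) auto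
        then have "int n * f r + r < int n * int m" using r by (simp add: algebra_simps)
        then show ?thesis using fr r by (simp add: h_def mult.commute add.commute)
      qed (use assms in \<open>simp add: h_def\<close>)
      moreover have "0 \<in> h f ` {0..<int n}"
        by (rule image_eqI[of _ _ 0]) (use assms in \<open>auto simp: h_def\<close>)
      ultimately show "h f ` {0..<int n} \<in> residue_sections n m"
        using bij by (auto simp: residue_sections_def)
    qed
    show "g \<in> residue_sections n m \<rightarrow> ?F"
    proof
      fix X assume X: "X \<in> residue_sections n m"
      have "inv_into X (\<lambda>x. x mod int n) r div int n \<in> {0..<int m}" if "r \<in> {1..<int n}" for r
      proof -
        have "r \<in> (\<lambda>x. x mod int n) ` X" using X that by (auto simp: residue_sections_def bij_betw_def)
        then have "inv_into X (\<lambda>x. x mod int n) r \<in> X" by (rule inv_into_into)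
        then have "inv_into X (\<lambda>x. x mod int n) r \<in> {0..<int m * int n}"
          using X by (auto simp: residue_sections_def)
        moreover have "z div int n < int m" if "z < int m * int n" for z
        proof (rule ccontr)
          assume "\<not> z div int n < int m"
          then have "int m * int n \<le> z div int n * int n" by (intro mult_right_mono) auto
          also have "\<dots> \<le> z" using div_mult_mod_eq[of z "int n"] assms by (smt (verit) Euclidean_Rings.pos_mod_sign of_nat_0_less_iff)
          finally show False using that by simp
        qed
        ultimately show ?thesis using assms by (auto simp: pos_imp_zdiv_nonneg_iff)
      qed
      then show "g X \<in> ?F" by (auto simp: g_def)
    qed
    show "g (h f ` {0..<int n}) = f" if f: "f \<in> ?F" for f
    proof
      fix r
      show "g (h f ` {0..<int n}) r = f r"
      proof (cases "r \<in> {1..<int n}")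
        case True
        then have "inv_into (h f ` {0..<int n}) (\<lambda>x. x mod int n) r = h f r"
          using bij_betw_imp_inj_on[OF bij] by (intro inv_into_f_eq) (auto simp: hmod)
        then show ?thesis using True by (simp add: g_def h_def)
      next
        case False
        then show ?thesis using PiE_arb[OF f False] by (auto simp: g_def)
      qed
    qed
    show "h (g X) ` {0..<int n} = X" if X: "X \<in> residue_sections n m" for X
    proof -
      have bX: "bij_betw (\<lambda>x. x mod int n) X {0..<int n}" and X0: "0 \<in> X"
        using X by (auto simp: residue_sections_def)
      have "h (g X) r = inv_into X (\<lambda>x. x mod int n) r" if r: "r \<in> {0..<int n}" for r
      proof (cases "r = 0")
        case True
        have "inv_into X (\<lambda>x. x mod int n) 0 = 0"
          using bij_betw_imp_inj_on[OF bX] X0 by (intro inv_into_f_eq) auto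
        then show ?thesis by (simp add: h_def True)
      next
        case False
        have "inv_into X (\<lambda>x. x mod int n) r mod int n = r"
          using bX r by (intro f_inv_into_f) (auto simp: bij_betw_def)
        then show ?thesis
          using False r mult_div_mod_eq[of "int n" "inv_into X (\<lambda>x. x mod int n) r"]
          by (simp add: h_def g_def)
      qed
      then show ?thesis using bij_betw_imp_surj_on[OF bij_betw_inv_into[OF bX]] by (metis image_cong)
    qed
  qed
  then have "card ?F = card (residue_sections n m)" by (rule bij_betw_same_card)
  then show ?thesis using assms by (simp add: card_PiE nat_diff_distrib)
qed

lemma card_center_seqs:
  assumes "n > 0" "m > 0"
  shows "card (center_seqs n m) = m ^ (n - 1)"
  using bij_betw_same_card[OF bij_betw_center_seqs[OF assms(1)]] card_residue_sections[OF assms] by simp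

lemma card_center_seqs_fixed:
  assumes "m > 0" "n > 0" "d dvd n"
  shows "card {P \<in> center_seqs n m. (advance ^^ d) P = P} =
           (if coprime (n div d) m then m ^ (d - 1) else 0)"
proof -
  have "d > 0" using assms by (auto intro: Nat.gr0I)
  moreover have "{P \<in> center_seqs n m. (advance ^^ d) P = P} =
      (if coprime (n div d) m then center_seqs d m else {})"
    using center_seqs_fixed_iff[of n "n div d" d _ m] assms by auto
  ultimately show ?thesis using card_center_seqs assms(1) by simp
qed

theorem center_seqs_words_bijection:
  assumes "n > 0" "m > 0"
  shows "\<exists>E. bij_betw E (center_seqs n m) (periodic_words n m) \<and>
           (\<forall>P\<in>center_seqs n m. E (advance P) = shift (E P))"
proof (rule equivariant_bijection_if_card_fixed_eq)
  show "finite (center_seqs n m)"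
    using card_center_seqs[OF assms] assms by (intro card_ge_0_finite) simp
  show "cyclic_on n advance (center_seqs n m)" by (rule cyclic_on_center_seqs)
  show "cyclic_on n shift (periodic_words n m)" by (rule cyclic_on_periodic_words)
qed (use assms in \<open>simp_all add: finite_periodic_words card_center_seqs_fixed card_periodic_words_fixed\<close>)

section \<open>Rounding real sequences\<close>

text \<open>These are the partial sum sequences of the points inside alcoves of the dilated simplex:
  monotonicity expresses the walls of the simplex, the last clause that no hyperplane is
  met.\<close>

definition alcove_seqs :: "nat \<Rightarrow> nat \<Rightarrow> (nat \<Rightarrow> real) set" where
  "alcove_seqs n m = {t. t 0 = 0 \<and> strict_mono t \<and> (\<forall>i. t (i + n) = t i + real m) \<and>
     (\<forall>i j. t i - t j \<in> \<int> \<longrightarrow> [i = j] (mod n))}"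

text \<open>Up to a constant, \<open>\<Sum>i<n. \<lfloor>t j - t i\<rfloor>\<close> is \<open>n * \<lfloor>t j\<rfloor>\<close> plus the rank of the fractional part of
  \<open>t j\<close> among those of \<open>t 0, \<dots>, t (n - 1)\<close>, so \<open>center n t / n\<close> is the point of the alcove of \<open>t\<close>
  with equally spaced fractional parts.\<close>

definition center :: "nat \<Rightarrow> (nat \<Rightarrow> real) \<Rightarrow> nat \<Rightarrow> int" where
  "center n t j = (\<Sum>i<n. \<lfloor>t j - t i\<rfloor>) - (\<Sum>i<n. \<lfloor>t 0 - t i\<rfloor>)"

lemma center_diff: "center n t i - center n t j = (\<Sum>l<n. \<lfloor>t i - t l\<rfloor> - \<lfloor>t j - t l\<rfloor>)"
  by (simp add: center_def sum_subtractf)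

lemma quasi_periodic_diff_Ints:
  fixes t :: "nat \<Rightarrow> real"
  assumes "\<And>i. t (i + n) = t i + real m"
  shows "t i - t (i mod n) \<in> \<int>"
  using quasi_periodic_mod[of t n "real m" i, OF assms] by simp

text \<open>Each summand in \<open>center_diff\<close> is \<open>\<lfloor>t i - t j\<rfloor>\<close>
  or one more. The index \<open>j mod n\<close> always gives the smaller value, and
  \<open>i mod n\<close> gives the larger one unless \<open>t i - t j\<close> is an integer.\<close>

lemma center_diff_bounds:
  assumes "n > 0" and t: "\<And>i. t (i + n) = t i + real m"
  shows "int n * \<lfloor>t i - t j\<rfloor> \<le> center n t i - center n t j"
    and "center n t i - center n t j < int n * \<lfloor>t i - t j\<rfloor> + int n"
    and "t i - t j \<notin> \<int> \<Longrightarrow> int n * \<lfloor>t i - t j\<rfloor> < center n t i - center n t j"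
proof -
  let ?D = "\<lambda>l. \<lfloor>t i - t l\<rfloor> - \<lfloor>t j - t l\<rfloor>" and ?q = "\<lfloor>t i - t j\<rfloor>"
  have lo: "?q \<le> ?D l" and hi: "?D l \<le> ?q + 1" for l by linarith+
  have "(\<Sum>l<n. ?q) \<le> (\<Sum>l<n. ?D l)" by (rule sum_mono) (rule lo)
  then show "int n * ?q \<le> center n t i - center n t j" by (simp add: center_diff)
  have "(\<Sum>l<n. ?D l) < (\<Sum>l<n. ?q + 1)"
  proof (rule sum_strict_mono_ex1)
    obtain z where z: "t j - t (j mod n) = of_int z"
      using quasi_periodic_diff_Ints[of t n m, OF t] by (auto elim: Ints_cases)
    then have "t i - t (j mod n) = (t i - t j) + of_int z" by simp
    then have "\<lfloor>t i - t (j mod n)\<rfloor> = ?q + z" by (simp only: floor_add_int)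
    moreover have "\<lfloor>t j - t (j mod n)\<rfloor> = z" using z by simp
    ultimately have "?D (j mod n) = ?q" by simp
    then show "\<exists>l\<in>{..<n}. ?D l < ?q + 1" using \<open>n > 0\<close> by (intro bexI[of _ "j mod n"]) auto
  qed (use hi in auto)
  then show "center n t i - center n t j < int n * ?q + int n"
    by (simp add: center_diff algebra_simps)
  assume nonint: "t i - t j \<notin> \<int>"
  have "(\<Sum>l<n. ?q) < (\<Sum>l<n. ?D l)"
  proof (rule sum_strict_mono_ex1)
    obtain z where z: "t i - t (i mod n) = of_int z"
      using quasi_periodic_diff_Ints[of t n m, OF t] by (auto elim: Ints_cases)
    have "t j - t (i mod n) = of_int z - (t i - t j)" using z by simp
    moreover have "of_int ?q < t i - t j" using nonint by (metis Ints_of_int floor_less_cancel floor_of_int of_int_floor_le order_le_less)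
    ultimately have "\<lfloor>t j - t (i mod n)\<rfloor> < z - ?q" by (simp add: floor_less_iff)
    then have "?q < ?D (i mod n)" using z by simp
    then show "\<exists>l\<in>{..<n}. ?q < ?D l" using \<open>n > 0\<close> by (intro bexI[of _ "i mod n"]) auto
  qed (use lo in auto)
  then show "int n * ?q < center n t i - center n t j" by (simp add: center_diff)
qed

text \<open>Hence the center sequence determines all floors of differences, which is what makes it
  separate alcoves.\<close>

lemma floor_eq_center_div:
  assumes "n > 0" and "\<And>i. t (i + n) = t i + real m"
  shows "\<lfloor>t i - t j\<rfloor> = (center n t i - center n t j) div int n"
  using center_diff_bounds(1,2)[of n t m i j, OF assms]
  by (intro int_div_pos_eq[symmetric, where r = "center n t i - center n t j - int n * \<lfloor>t i - t j\<rfloor>"]) auto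

lemma center_in_center_seqs:
  assumes "n > 0" and "t \<in> alcove_seqs n m"
  shows "center n t \<in> center_seqs n m"
proof -
  have mono: "strict_mono t" and per: "\<And>i. t (i + n) = t i + real m"
    and inj: "\<And>i j. t i - t j \<in> \<int> \<Longrightarrow> [i = j] (mod n)"
    using assms by (auto simp: alcove_seqs_def)
  note bounds = center_diff_bounds[of n t m, OF \<open>n > 0\<close> per]
  have pern: "center n t (i + n) = center n t i + int (m * n)" for i
  proof -
    have "\<lfloor>t (i + n) - t l\<rfloor> - \<lfloor>t i - t l\<rfloor> = int m" for l
    proof -
      have "t (i + n) - t l = (t i - t l) + of_int (int m)" by (simp add: per)
      then show ?thesis by linarith
    qed
    then show ?thesis using center_diff[of n t "i + n" i] by (simp add: mult.commute)
  qed
  have "center n t i < center n t (Suc i)" for i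
  proof (cases "t (Suc i) - t i \<in> \<int>")
    case True
    then have "of_int \<lfloor>t (Suc i) - t i\<rfloor> = t (Suc i) - t i" by (rule of_int_floor)
    moreover have "t i < t (Suc i)" using mono by (simp add: strict_mono_Suc_iff)
    ultimately have "\<lfloor>t (Suc i) - t i\<rfloor> > 0" by linarith
    then have "0 < int n * \<lfloor>t (Suc i) - t i\<rfloor>" using \<open>n > 0\<close> by simp
    then show ?thesis using bounds(1)[of "Suc i" i] by linarith
  next
    case False
    have "t i < t (Suc i)" using mono by (simp add: strict_mono_Suc_iff)
    then have "0 \<le> int n * \<lfloor>t (Suc i) - t i\<rfloor>" by simp
    then show ?thesis using bounds(3)[OF False] by linarith
  qed
  moreover have "[i = j] (mod n)" if ij: "[center n t i = center n t j] (mod int n)" for i j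
  proof (rule inj, rule ccontr)
    \<comment> \<open>For a non-integral difference the bounds are strict on both sides, so the
      difference of centers lies between consecutive multiples of \<open>n\<close>.\<close>
    assume "t i - t j \<notin> \<int>"
    then have *: "int n * \<lfloor>t i - t j\<rfloor> < center n t i - center n t j"
        "center n t i - center n t j < int n * (\<lfloor>t i - t j\<rfloor> + 1)"
      using bounds(2,3)[of i j] by (auto simp: algebra_simps)
    obtain c where "center n t i - center n t j = int n * c"
      using ij by (auto simp: cong_iff_dvd_diff)
    then show False using * \<open>n > 0\<close> by simp
  qed
  ultimately show ?thesis using pern by (auto simp: center_seqs_def strict_mono_Suc_iff center_def)
qed

text \<open>Moving the summation window by one replaces index 0 by index \<open>n\<close>. This
  lowers every such sum by the same \<open>m\<close>, which cancels in the difference defining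
  \<open>center\<close>.\<close>

lemma center_advance:
  assumes "\<And>i. t (i + n) = t i + real m"
  shows "center n (advance t) = advance (center n t)"
proof
  fix j
  have *: "(\<Sum>i<n. \<lfloor>t a - t (Suc i)\<rfloor>) = (\<Sum>i<n. \<lfloor>t a - t i\<rfloor>) - int m" for a
  proof -
    have "t a - t n = (t a - t 0) - of_int (int m)" using assms[of 0] by simp
    then have "\<lfloor>t a - t n\<rfloor> = \<lfloor>t a - t 0\<rfloor> - int m" by (simp only: floor_diff_of_int)
    then show ?thesis
      using sum.lessThan_Suc[of "\<lambda>i. \<lfloor>t a - t i\<rfloor>" n] sum.lessThan_Suc_shift[of "\<lambda>i. \<lfloor>t a - t i\<rfloor>" n]
      by simp
  qed
  show "center n (advance t) j = advance (center n t) j"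
    by (simp add: center_def advance_def *)
qed

text \<open>While \<open>l\<close> runs over one period, \<open>P i - P l\<close> runs over all
  residues modulo \<open>n\<close>. So the rounding errors in the sum of floors have a total
  independent of \<open>i\<close>, which cancels in \<open>center\<close>.\<close>

lemma center_of_center_seq:
  assumes "n > 0" and P: "P \<in> center_seqs n m"
  defines "t \<equiv> \<lambda>i. real_of_int (P i) / real n"
  shows "t \<in> alcove_seqs n m" "center n t = P"
proof -
  have P0: "P 0 = 0" and per: "\<And>i. P (i + n) = P i + int (m * n)" and mono: "strict_mono P"
    and inj: "\<And>i j. [P i = P j] (mod int n) \<Longrightarrow> [i = j] (mod n)"
    using P by (auto simp: center_seqs_def)
  have diff: "t i - t j = real_of_int (P i - P j) / real_of_int (int n)" for i j
    by (simp add: t_def diff_divide_distrib)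
  have "[i = j] (mod n)" if ij: "t i - t j \<in> \<int>" for i j
  proof -
    obtain z where "t i - t j = of_int z" by (rule Ints_cases[OF ij])
    then have "real_of_int (P i - P j) / real_of_int (int n) = of_int z" unfolding diff .
    then have "real_of_int (P i - P j) = real_of_int (z * int n)" using \<open>n > 0\<close> by (simp add: field_simps)
    then have "P i - P j = z * int n" by linarith
    then show ?thesis by (intro inj) (simp add: cong_iff_dvd_diff)
  qed
  moreover have "t (i + n) = t i + real m" for i
    using \<open>n > 0\<close> by (simp add: t_def per field_simps)
  ultimately show "t \<in> alcove_seqs n m"
    using mono P0 \<open>n > 0\<close> by (auto simp: alcove_seqs_def t_def strict_mono_def divide_strict_right_mono)
  have floor: "\<lfloor>t i - t j\<rfloor> = (P i - P j) div int n" for i j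
    unfolding diff by (rule floor_divide_of_int_eq)
  have S: "int n * (\<Sum>l<n. \<lfloor>t i - t l\<rfloor>) = int n * P i - (\<Sum>l<n. P l) - \<Sum>{0..<int n}" for i
  proof -
    have "inj_on (\<lambda>l. (P i - P l) mod int n) {..<n}"
    proof (rule inj_onI)
      fix a b assume ab: "a \<in> {..<n}" "b \<in> {..<n}" "(P i - P a) mod int n = (P i - P b) mod int n"
      then have "[P i - P a = P i - P b] (mod int n)" by (simp only: cong_def)
      then have "[P i - (P i - P a) = P i - (P i - P b)] (mod int n)"
        by (rule cong_diff[OF cong_refl])
      then have "[a = b] (mod n)" by (intro inj) simp
      then show "a = b" using ab by (simp add: cong_def)
    qed
    moreover have "(\<lambda>l. (P i - P l) mod int n) ` {..<n} \<subseteq> {0..<int n}" using \<open>n > 0\<close> by auto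
    ultimately have "bij_betw (\<lambda>l. (P i - P l) mod int n) {..<n} {0..<int n}"
      unfolding bij_betw_def by (simp add: card_subset_eq card_image)
    then have "(\<Sum>l<n. (P i - P l) mod int n) = \<Sum>{0..<int n}"
      by (rule sum.reindex_bij_betw)
    moreover have "int n * (\<Sum>l<n. \<lfloor>t i - t l\<rfloor>) = (\<Sum>l<n. (P i - P l) - (P i - P l) mod int n)"
      by (simp add: floor sum_distrib_left minus_mod_eq_mult_div)
    ultimately show ?thesis by (simp add: sum_subtractf)
  qed
  show "center n t = P"
  proof
    fix i
    have "int n * center n t i = int n * P i"
      using S[of i] S[of 0] P0 by (simp add: center_def right_diff_distrib)
    then show "center n t i = P i" using \<open>n > 0\<close> by simp
  qed
qed

section \<open>Alcoves\<close>

definition regular_points :: "'a::euclidean_space set \<Rightarrow> 'a set" where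
  "regular_points \<Phi> = {x. \<forall>r\<in>\<Phi>. r \<bullet> x \<notin> \<int>}"

definition cell :: "'a::euclidean_space set \<Rightarrow> 'a \<Rightarrow> 'a set" where
  "cell \<Phi> x = {y \<in> regular_points \<Phi>. \<forall>r\<in>\<Phi>. \<lfloor>r \<bullet> y\<rfloor> = \<lfloor>r \<bullet> x\<rfloor>}"

lemma floor_eq_not_Ints_iff:
  "\<lfloor>u\<rfloor> = z \<and> u \<notin> \<int> \<longleftrightarrow> of_int z < u \<and> u < of_int z + 1" for u :: real
proof
  assume u: "\<lfloor>u\<rfloor> = z \<and> u \<notin> \<int>"
  then have "of_int z \<noteq> u" by auto
  then show "of_int z < u \<and> u < of_int z + 1" using u by linarith
next
  assume u: "of_int z < u \<and> u < of_int z + 1"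
  then have "\<lfloor>u\<rfloor> = z" by linarith
  moreover have "u \<notin> \<int>" using u by (auto elim!: Ints_cases)
  ultimately show "\<lfloor>u\<rfloor> = z \<and> u \<notin> \<int>" ..
qed

lemma convex_cell: "convex (cell \<Phi> x)"
proof -
  have "cell \<Phi> x = (\<Inter>r\<in>\<Phi>. {y. r \<bullet> y > of_int \<lfloor>r \<bullet> x\<rfloor>} \<inter> {y. r \<bullet> y < of_int \<lfloor>r \<bullet> x\<rfloor> + 1})"
    using floor_eq_not_Ints_iff by (fastforce simp: cell_def regular_points_def)
  then show ?thesis by (auto intro!: convex_INT convex_Int convex_halfspace_gt convex_halfspace_lt)
qed

text \<open>A cell is an intersection of open strips, hence convex and connected. Conversely, if the
  floor of \<open>r \<bullet> z\<close> changed on a connected set, its image, an interval, would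
  contain an integer, so the set would meet a hyperplane.\<close>

lemma connected_component_regular_points:
  assumes "x \<in> regular_points \<Phi>"
  shows "connected_component_set (regular_points \<Phi>) x = cell \<Phi> x"
proof
  have "connected (cell \<Phi> x)" by (rule convex_connected[OF convex_cell])
  then show "cell \<Phi> x \<subseteq> connected_component_set (regular_points \<Phi>) x"
    using assms by (intro connected_component_maximal) (auto simp: cell_def)
  show "connected_component_set (regular_points \<Phi>) x \<subseteq> cell \<Phi> x"
  proof
    fix y assume "y \<in> connected_component_set (regular_points \<Phi>) x"
    then obtain C where C: "connected C" "C \<subseteq> regular_points \<Phi>" "x \<in> C" "y \<in> C"
      by (auto simp: connected_component_def)
    have "\<lfloor>r \<bullet> y\<rfloor> = \<lfloor>r \<bullet> x\<rfloor>" if r: "r \<in> \<Phi>" for r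
    proof -
      have conn: "connected ((\<lambda>z. r \<bullet> z) ` C)"
        using C(1) by (intro connected_continuous_image continuous_intros)
      have no: "\<lfloor>b\<rfloor> \<le> \<lfloor>a\<rfloor>" if ab: "a \<in> (\<lambda>z. r \<bullet> z) ` C" "b \<in> (\<lambda>z. r \<bullet> z) ` C" for a b
      proof (rule ccontr)
        assume "\<not> \<lfloor>b\<rfloor> \<le> \<lfloor>a\<rfloor>"
        then have "a \<le> of_int \<lfloor>b\<rfloor>" "of_int \<lfloor>b\<rfloor> \<le> b" by linarith+
        then have "of_int \<lfloor>b\<rfloor> \<in> (\<lambda>z. r \<bullet> z) ` C"
          using connectedD_interval[OF conn ab] by blast
        then obtain z where z: "z \<in> C" "r \<bullet> z = of_int \<lfloor>b\<rfloor>" by auto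
        have "r \<bullet> z \<notin> \<int>" using C(2) r z(1) unfolding regular_points_def by blast
        then show False using z(2) by simp
      qed
      show ?thesis using no[of "r \<bullet> x" "r \<bullet> y"] no[of "r \<bullet> y" "r \<bullet> x"] C by force
    qed
    then show "y \<in> cell \<Phi> x" using C by (auto simp: cell_def)
  qed
qed

lemma alcoves_eq_cells: "alcoves \<Phi> = cell \<Phi> ` regular_points \<Phi>"
proof -
  have "UNIV - (\<Union>r\<in>\<Phi>. \<Union>p. hyperplane r p) = regular_points \<Phi>"
    by (auto simp: regular_points_def hyperplane_def elim!: Ints_cases)
  then show ?thesis
    unfolding alcoves_def components_def by (simp add: connected_component_regular_points)
qed

section \<open>The dilated simplex of type A\<close>

text \<open>Entries with sum 0 that are not all 0 include a positive and a negative one; these two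
  already contribute at least 2 to the squares, so they are 1 and -1 and nothing is left.\<close>

lemma two_entries_if_sum_squares_2:
  fixes d :: "'a \<Rightarrow> int"
  assumes "finite A" "(\<Sum>j\<in>A. d j) = 0" "(\<Sum>j\<in>A. (d j)\<^sup>2) = 2"
  obtains a b where "a \<in> A" "b \<in> A" "a \<noteq> b" "d a = 1" "d b = -1" "\<And>j. j \<in> A - {a, b} \<Longrightarrow> d j = 0"
proof -
  have "\<exists>a\<in>A. d a > 0"
  proof (rule ccontr)
    assume neg: "\<not> (\<exists>a\<in>A. d a > 0)"
    then have "(\<Sum>j\<in>A. - d j) = 0 \<longleftrightarrow> (\<forall>j\<in>A. - d j = 0)"
      using assms(1) by (intro sum_nonneg_eq_0_iff) auto
    then show False using assms by (simp add: sum_negf)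
  qed
  then obtain a where a: "a \<in> A" "d a > 0" by blast
  have "\<exists>b\<in>A. d b < 0"
  proof (rule ccontr)
    assume neg: "\<not> (\<exists>b\<in>A. d b < 0)"
    then have "(\<Sum>j\<in>A. d j) = 0 \<longleftrightarrow> (\<forall>j\<in>A. d j = 0)"
      using assms(1) by (intro sum_nonneg_eq_0_iff) auto
    then show False using assms by simp
  qed
  then obtain b where b: "b \<in> A" "d b < 0" by blast
  have "a \<noteq> b" using a b by auto
  have "A = insert a (insert b (A - {a, b}))" using a b by blast
  then have "(\<Sum>j\<in>A. (d j)\<^sup>2) = (\<Sum>j\<in>insert a (insert b (A - {a, b})). (d j)\<^sup>2)" by simp
  also have "\<dots> = (d a)\<^sup>2 + ((d b)\<^sup>2 + (\<Sum>j\<in>A - {a, b}. (d j)\<^sup>2))"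
    using assms(1) \<open>a \<noteq> b\<close> by simp
  finally have eq: "(d a)\<^sup>2 + (d b)\<^sup>2 + (\<Sum>j\<in>A - {a, b}. (d j)\<^sup>2) = 2" using assms(3) by simp
  have ge: "d a \<le> (d a)\<^sup>2" "- d b \<le> (d b)\<^sup>2"
    using a b self_le_power[of "d a" 2] self_le_power[of "- d b" 2] by auto
  have nn: "0 \<le> (\<Sum>j\<in>A - {a, b}. (d j)\<^sup>2)" by (rule sum_nonneg) simp
  have "d a = 1" "d b = -1" "(\<Sum>j\<in>A - {a, b}. (d j)\<^sup>2) = 0"
    using eq ge nn a b by linarith+
  moreover from this(3) have "d j = 0" if "j \<in> A - {a, b}" for j
    using that assms(1) by (subst (asm) sum_nonneg_eq_0_iff) auto
  ultimately show thesis using that a b \<open>a \<noteq> b\<close> by blast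
qed

lemma summation_by_parts:
  fixes e h :: "nat \<Rightarrow> 'a::comm_ring"
  shows "(\<Sum>j<k. e (Suc j) * (h (Suc j) - h j)) =
     (\<Sum>j\<le>k. (e j - e (Suc j)) * h j) + e (Suc k) * h k - e 0 * h 0"
  by (induction k) (auto simp: algebra_simps)

locale type_A_simplex =
  fixes k m :: nat and \<Phi> :: "'a::euclidean_space set" and \<alpha> v :: "nat \<Rightarrow> 'a"
    and \<rho> :: "'a \<Rightarrow> 'a"
  assumes k: "k \<ge> 1" and m: "m \<ge> 1"
    and root_system: "root_system \<Phi>" and simple_roots: "simple_roots \<Phi> k \<alpha>"
    and cartan: "cartan_type_A k \<alpha>"
    and norm_root: "\<forall>r\<in>\<Phi>. r \<bullet> r = 2"
    and v0: "v 0 = 0"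
    and v: "\<forall>i\<in>{1..k}. \<forall>j\<in>{1..k}. \<alpha> j \<bullet> v i = (if i = j then real m else 0)"
    and affine: "affine_map \<rho>"
    and rho_v: "\<forall>i\<in>{0..k}. \<rho> (v i) = v ((i + 1) mod (k + 1))"
begin

text \<open>\<open>gap x\<close> lists the barycentric coordinates of \<open>x\<close> (times \<open>m\<close>) from \<open>v k\<close> down to \<open>v 0\<close>;
  in this order \<open>\<rho>\<close>, which moves \<open>v i\<close> to \<open>v (i + 1)\<close>, acts as a left shift.\<close>

definition gap :: "'a \<Rightarrow> nat \<Rightarrow> real" where
  "gap x j = (if j mod (k + 1) = k then real m - (\<Sum>i=1..k. \<alpha> i \<bullet> x)
              else \<alpha> (k - j mod (k + 1)) \<bullet> x)"

definition height :: "'a \<Rightarrow> nat \<Rightarrow> real" where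
  "height x i = (\<Sum>j<i. gap x j)"

lemma height_0 [simp]: "height x 0 = 0"
  by (simp add: height_def)

lemma height_Suc: "height x (Suc i) = height x i + gap x i"
  by (simp add: height_def)

lemma gap_less: "j < k \<Longrightarrow> gap x j = \<alpha> (k - j) \<bullet> x"
  by (simp add: gap_def)

lemma sum_rev: "(\<Sum>j<k. f (k - j)) = (\<Sum>i=1..k. f i)" for f :: "nat \<Rightarrow> 'b::comm_monoid_add"
  by (rule sum.reindex_bij_witness[of _ "\<lambda>i. k - i" "\<lambda>j. k - j"]) auto

lemma height_k: "height x k = (\<Sum>i=1..k. \<alpha> i \<bullet> x)"
  using sum_rev[of "\<lambda>i. \<alpha> i \<bullet> x"] by (simp add: height_def gap_less)

lemma gap_k: "gap x k = real m - height x k"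
  by (simp add: gap_def height_k)

lemma gap_periodic: "gap x (i + (k + 1)) = gap x i"
  by (simp only: gap_def mod_add_self2)

lemma height_periodic: "height x (i + (k + 1)) = height x i + real m"
proof (induction i)
  case 0
  show ?case using height_Suc[of x k] by (simp add: gap_k)
next
  case (Suc i)
  then show ?case using height_Suc[of x i] height_Suc[of x "i + (k + 1)"] gap_periodic[of x i] by simp
qed

lemma height_mod: "height x i = height x (i mod (k + 1)) + real (i div (k + 1)) * real m"
  using quasi_periodic_mod[of "height x" "k + 1" "real m" i, OF height_periodic] .

section \<open>Roots as differences of heights\<close>

lemma simple_root_in: "i \<in> {1..k} \<Longrightarrow> \<alpha> i \<in> \<Phi>"
  using simple_roots by (auto simp: simple_roots_def)

lemma inner_simple_roots:
  assumes "i \<in> {1..k}" "j \<in> {1..k}"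
  shows "\<alpha> i \<bullet> \<alpha> j = (if i = j then 2 else if i = j + 1 \<or> j = i + 1 then - 1 else 0)"
proof -
  have "\<alpha> i \<bullet> \<alpha> i = 2" using norm_root simple_root_in[OF assms(1)] by blast
  then show ?thesis using cartan assms unfolding cartan_type_A_def by (metis (no_types, lifting) nonzero_mult_div_cancel_left zero_neq_numeral)
qed

lemma inner_rev_simple_roots:
  assumes "i < k" "j < k"
  shows "\<alpha> (k - i) \<bullet> \<alpha> (k - j) = (if i = j then 2 else if i = j + 1 \<or> j = i + 1 then - 1 else 0)"
proof -
  have "k - i = k - j \<longleftrightarrow> i = j" "k - i = k - j + 1 \<longleftrightarrow> j = i + 1" "k - j = k - i + 1 \<longleftrightarrow> i = j + 1"
    using assms by linarith+
  then show ?thesis using inner_simple_roots[of "k - i" "k - j"] assms by auto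
qed

lemma reflect_root:
  assumes "r \<in> \<Phi>" "s \<in> \<Phi>"
  shows "s - (r \<bullet> s) *\<^sub>R r \<in> \<Phi>"
proof -
  have "reflect r s \<in> \<Phi>" using root_system assms by (auto simp: root_system_def)
  then show ?thesis using norm_root assms by (simp add: reflect_def)
qed

lemma uminus_root: "r \<in> \<Phi> \<Longrightarrow> - r \<in> \<Phi>"
  using reflect_root[of r r] norm_root by (simp add: scaleR_2)

text \<open>Only the last summand is adjacent to the next simple root in the Dynkin diagram. Their
  inner product is -1, so reflecting in the next simple root appends it.\<close>

lemma interval_root:
  assumes "b < a" "a \<le> k"
  shows "(\<Sum>j=b..<a. \<alpha> (k - j)) \<in> \<Phi>"
  using assms
proof (induction a)
  case (Suc a)
  show ?case
  proof (cases "a = b")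
    case True
    then show ?thesis using Suc.prems simple_root_in by simp
  next
    case False
    let ?r = "\<Sum>j=b..<a. \<alpha> (k - j)"
    have r: "?r \<in> \<Phi>" using Suc False by simp
    have "\<alpha> (k - a) \<bullet> ?r = (\<Sum>j=b..<a. \<alpha> (k - a) \<bullet> \<alpha> (k - j))" by (rule inner_sum_right)
    also have "\<dots> = (\<Sum>j=b..<a. if j = a - 1 then -1 else 0)"
      using Suc.prems by (intro sum.cong) (auto simp: inner_rev_simple_roots)
    also have "\<dots> = -1" using Suc.prems False by simp
    finally have "\<alpha> (k - a) \<bullet> ?r = -1" .
    then have "?r + \<alpha> (k - a) \<in> \<Phi>"
      using reflect_root[OF simple_root_in r, of "k - a"] Suc.prems by simp
    then show ?thesis using Suc.prems by simp
  qed
qed simp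

lemma root_of_heights:
  assumes "a \<le> k" "b \<le> k" "a \<noteq> b"
  shows "\<exists>r\<in>\<Phi>. \<forall>x. r \<bullet> x = height x a - height x b"
proof -
  have *: "\<exists>r\<in>\<Phi>. \<forall>x. r \<bullet> x = height x a - height x b" if "b < a" "a \<le> k" for a b
  proof (intro bexI[OF _ interval_root[OF that]] allI)
    fix x
    have "(\<Sum>j=b..<a. \<alpha> (k - j)) \<bullet> x = (\<Sum>j=b..<a. gap x j)"
      unfolding inner_sum_left using that by (intro sum.cong) (auto simp: gap_less)
    also have "\<dots> = height x a - height x b"
      using that sum_diff_nat_ivl[of 0 b a "gap x"] by (simp add: height_def atLeast0LessThan)
    finally show "(\<Sum>j=b..<a. \<alpha> (k - j)) \<bullet> x = height x a - height x b" .
  qed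
  show ?thesis
  proof (cases "b < a")
    case True
    then show ?thesis using * assms by blast
  next
    case False
    then obtain r where "r \<in> \<Phi>" "\<forall>x. r \<bullet> x = height x b - height x a"
      using *[of a b] assms by auto
    then show ?thesis by (intro bexI[of _ "- r"]) (auto intro: uminus_root)
  qed
qed

text \<open>Let \<open>d\<close> be the successive differences of the coefficients of a root \<open>r\<close>. By the type \<open>A\<close> Cartan
  matrix \<open>r \<bullet> r\<close> is the sum of the squares of \<open>d\<close>, so \<open>d\<close> has exactly two nonzero entries,
  \<open>1\<close> and \<open>-1\<close>.\<close>

lemma heights_of_root:
  assumes r: "r \<in> \<Phi>"
  shows "\<exists>a b. a \<le> k \<and> b \<le> k \<and> a \<noteq> b \<and> (\<forall>x. r \<bullet> x = height x a - height x b)"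
proof -
  obtain c :: "nat \<Rightarrow> int" where c: "r = (\<Sum>i=1..k. of_int (c i) *\<^sub>R \<alpha> i)"
    using simple_roots r unfolding simple_roots_def by blast
  \<comment> \<open>The coefficients are reversed to match the order of \<open>gap\<close> and
    padded with 0 at both ends, which removes the boundary terms of the summation by parts.\<close>
  define e where "e j = (if 1 \<le> j \<and> j \<le> k then c (k + 1 - j) else 0)" for j
  define d where "d j = e j - e (Suc j)" for j
  have e0: "e 0 = 0" and ek: "e (Suc k) = 0" by (auto simp: e_def)
  have "r = (\<Sum>j<k. of_int (c (k - j)) *\<^sub>R \<alpha> (k - j))"
    unfolding c by (rule sum_rev[symmetric])
  then have re: "r = (\<Sum>j<k. of_int (e (Suc j)) *\<^sub>R \<alpha> (k - j))"
    by (simp add: e_def)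
  have parts: "r \<bullet> x = (\<Sum>j\<le>k. of_int (d j) * height x j)" for x
  proof -
    have "r \<bullet> x = (\<Sum>j<k. of_int (e (Suc j)) * (height x (Suc j) - height x j))"
      unfolding re by (simp add: inner_sum_left height_Suc gap_less)
    then show ?thesis
      using summation_by_parts[of "\<lambda>j. of_int (e j)" "height x" k] e0 ek by (simp add: d_def)
  qed
  have sum0: "(\<Sum>j\<le>k. d j) = 0"
    using summation_by_parts[of e "\<lambda>_. 1" k] e0 ek by (simp add: d_def)
  \<comment> \<open>The Cartan matrix acts as a second difference on \<open>e\<close>, that is, as a
    first difference on \<open>d\<close>; summing gives the heights of \<open>r\<close> itself. The
    neighbour \<open>l - 1\<close> is excluded by hand for \<open>l = 0\<close>, where truncated
    subtraction would name \<open>l\<close> again.\<close>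
  have gap_r: "\<alpha> (k - l) \<bullet> r = of_int (d (Suc l) - d l)" if l: "l < k" for l
  proof -
    have "\<alpha> (k - l) \<bullet> r = (\<Sum>j<k. of_int (e (Suc j)) * (\<alpha> (k - l) \<bullet> \<alpha> (k - j)))"
      unfolding re by (simp add: inner_sum_right)
    also have "\<dots> = (\<Sum>j<k. (if j = l then 2 * of_int (e (Suc j)) else 0)
        - (if j = l - 1 then (if l = 0 then 0 else of_int (e (Suc j))) else 0)
        - (if j = l + 1 then of_int (e (Suc j)) else 0))"
      using l by (intro sum.cong) (auto simp: inner_rev_simple_roots)
    also have "\<dots> = 2 * of_int (e (Suc l)) - of_int (e l) - of_int (e (Suc (Suc l)))"
      using l e0 ek by (cases "Suc l = k") (auto simp: sum_subtractf sum.delta)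
    finally show ?thesis by (simp add: d_def)
  qed
  have height_r: "height r j = of_int (d j - d 0)" if "j \<le> k" for j
    using that by (induction j) (auto simp: height_Suc gap_less gap_r)
  \<comment> \<open>Applying \<open>parts\<close> to \<open>r\<close> itself expresses
    \<open>r \<bullet> r\<close> by \<open>d\<close>; the constant \<open>d 0\<close> in
    \<open>height_r\<close> drops out because the entries of \<open>d\<close> sum to 0.\<close>
  have "real_of_int (\<Sum>j\<le>k. (d j)\<^sup>2) = (\<Sum>j\<le>k. of_int (d j) * height r j) + of_int (d 0) * of_int (\<Sum>j\<le>k. d j)"
    by (simp add: height_r sum_distrib_left sum.distrib[symmetric] power2_eq_square algebra_simps)
  also have "\<dots> = 2" using parts[of r] norm_root r sum0 by simp
  finally have "(\<Sum>j\<le>k. (d j)\<^sup>2) = 2" by linarith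
  then obtain a b where ab: "a \<le> k" "b \<le> k" "a \<noteq> b" "d a = 1" "d b = -1"
      and zero: "\<And>j. j \<in> {..k} - {a, b} \<Longrightarrow> d j = 0"
    using two_entries_if_sum_squares_2[of "{..k}" d] sum0 by auto
  have "r \<bullet> x = height x a - height x b" for x
  proof -
    have "r \<bullet> x = (\<Sum>j\<in>{a, b}. of_int (d j) * height x j)"
      unfolding parts using ab zero by (intro sum.mono_neutral_right) auto
    then show ?thesis using ab by simp
  qed
  then show ?thesis using ab by blast
qed

section \<open>Regular points, cells and the simplex in terms of heights\<close>

text \<open>Roots are the height differences for distinct indices up to \<open>k\<close>; reducing
  other indices modulo \<open>k + 1\<close> changes heights by multiples of \<open>m\<close>, so
  integrality is unaffected. The same reduction lets cells be described by arbitrary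
  indices.\<close>

lemma regular_iff:
  "x \<in> regular_points \<Phi> \<longleftrightarrow> (\<forall>i j. height x i - height x j \<in> \<int> \<longrightarrow> [i = j] (mod (k + 1)))"
proof
  assume x: "x \<in> regular_points \<Phi>"
  show "\<forall>i j. height x i - height x j \<in> \<int> \<longrightarrow> [i = j] (mod (k + 1))"
  proof (intro allI impI, rule ccontr)
    fix i j assume ij: "height x i - height x j \<in> \<int>" "\<not> [i = j] (mod (k + 1))"
    have "i mod (k + 1) \<le> k" "j mod (k + 1) \<le> k" "i mod (k + 1) \<noteq> j mod (k + 1)"
      using ij(2) by (auto simp: cong_def less_Suc_eq_le[symmetric])
    then obtain r where r: "r \<in> \<Phi>" "r \<bullet> x = height x (i mod (k + 1)) - height x (j mod (k + 1))"
      using root_of_heights by blast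
    have "r \<bullet> x = (height x i - height x j)
        - of_nat (i div (k + 1) * m) + of_nat (j div (k + 1) * m)"
      using r(2) height_mod[of x i] height_mod[of x j] by simp
    then have "r \<bullet> x \<in> \<int>" using ij(1) by (simp only: Ints_add Ints_diff Ints_of_nat)
    then show False using x r(1) by (simp add: regular_points_def)
  qed
next
  assume x: "\<forall>i j. height x i - height x j \<in> \<int> \<longrightarrow> [i = j] (mod (k + 1))"
  have "r \<bullet> x \<notin> \<int>" if "r \<in> \<Phi>" for r
  proof
    assume "r \<bullet> x \<in> \<int>"
    moreover obtain a b where ab: "a \<le> k" "b \<le> k" "a \<noteq> b" "r \<bullet> x = height x a - height x b"
      using heights_of_root[OF \<open>r \<in> \<Phi>\<close>] by blast
    ultimately have "[a = b] (mod (k + 1))" using x by simp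
    then show False using ab by (simp add: cong_def)
  qed
  then show "x \<in> regular_points \<Phi>" by (simp add: regular_points_def)
qed

lemma mem_cell_iff:
  "y \<in> cell \<Phi> x \<longleftrightarrow> y \<in> regular_points \<Phi> \<and>
     (\<forall>i j. \<lfloor>height y i - height y j\<rfloor> = \<lfloor>height x i - height x j\<rfloor>)"
proof -
  have "\<lfloor>height y i - height y j\<rfloor> = \<lfloor>height x i - height x j\<rfloor>"
    if xy: "\<forall>r\<in>\<Phi>. \<lfloor>r \<bullet> y\<rfloor> = \<lfloor>r \<bullet> x\<rfloor>" for i j
  proof -
    let ?i = "i mod (k + 1)" and ?j = "j mod (k + 1)"
    define z where "z = int (i div (k + 1) * m) - int (j div (k + 1) * m)"
    have "\<lfloor>height y ?i - height y ?j\<rfloor> = \<lfloor>height x ?i - height x ?j\<rfloor>"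
    proof (cases "?i = ?j")
      case False
      have "?i \<le> k" "?j \<le> k" by (simp_all add: less_Suc_eq_le[symmetric])
      then obtain r where "r \<in> \<Phi>" "\<forall>x. r \<bullet> x = height x ?i - height x ?j"
        using root_of_heights[OF _ _ False] by blast
      then show ?thesis using xy by force
    qed simp
    moreover have "height w i - height w j = (height w ?i - height w ?j) + of_int z" for w
      using height_mod[of w i] height_mod[of w j] by (simp add: z_def)
    ultimately show ?thesis by (simp only: flip: floor_add_int)
  qed
  moreover have "\<lfloor>r \<bullet> y\<rfloor> = \<lfloor>r \<bullet> x\<rfloor>"
    if "\<forall>i j. \<lfloor>height y i - height y j\<rfloor> = \<lfloor>height x i - height x j\<rfloor>" "r \<in> \<Phi>" for r
    using heights_of_root[OF that(2)] that(1) by metis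
  ultimately show ?thesis by (auto simp: cell_def)
qed

lemma simplex_iff: "x \<in> dilated_simplex k \<alpha> m \<longleftrightarrow> (\<forall>i. 0 \<le> gap x i)"
proof -
  have "(\<forall>i. 0 \<le> gap x i) \<longleftrightarrow> (\<forall>i\<le>k. 0 \<le> gap x i)"
  proof (intro iffI allI)
    fix i assume *: "\<forall>i\<le>k. 0 \<le> gap x i"
    have "i mod (k + 1) \<le> k" by (simp add: less_Suc_eq_le[symmetric])
    then have "0 \<le> gap x (i mod (k + 1))" using * by blast
    then show "0 \<le> gap x i" using periodic_mod[of "gap x" "k + 1" i, OF gap_periodic] by simp
  qed auto
  also have "\<dots> \<longleftrightarrow> (\<forall>j<k. 0 \<le> \<alpha> (k - j) \<bullet> x) \<and> (\<Sum>i=1..k. \<alpha> i \<bullet> x) \<le> real m"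
    by (auto simp: le_less gap_less gap_k height_k)
  also have "(\<forall>j<k. 0 \<le> \<alpha> (k - j) \<bullet> x) \<longleftrightarrow> (\<forall>i\<in>{1..k}. 0 \<le> \<alpha> i \<bullet> x)"
  proof (intro iffI ballI allI impI)
    fix i assume "\<forall>j<k. 0 \<le> \<alpha> (k - j) \<bullet> x" "i \<in> {1..k}"
    then show "0 \<le> \<alpha> i \<bullet> x" by (auto dest!: spec[of _ "k - i"])
  qed auto
  finally show ?thesis by (simp add: dilated_simplex_def alpha0_def inner_sum_left)
qed

text \<open>The simplex asks only for nonnegative gaps, but a zero gap would give equal heights at
  consecutive indices, which are incongruent modulo \<open>k + 1\<close> as
  \<open>k \<ge> 1\<close>. So regular points of the simplex have strictly increasing
  heights.\<close>

lemma alcove_seqs_iff: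
  "height x \<in> alcove_seqs (k + 1) m \<longleftrightarrow> x \<in> regular_points \<Phi> \<inter> dilated_simplex k \<alpha> m"
proof -
  have pos: "0 < gap x i \<longleftrightarrow> 0 \<le> gap x i" if x: "x \<in> regular_points \<Phi>" for i
  proof -
    have "gap x i \<noteq> 0"
    proof
      assume "gap x i = 0"
      then have "height x (Suc i) - height x i \<in> \<int>" by (simp add: height_Suc)
      then have "[i + 1 = i] (mod (k + 1))" using x regular_iff by simp
      then have "k + 1 dvd 1" by (simp only: cong_add_lcancel_0_nat cong_0_iff)
      then show False using k by simp
    qed
    then show ?thesis by auto
  qed
  have mono: "strict_mono (height x) \<longleftrightarrow> (\<forall>i. 0 < gap x i)"
    by (simp add: strict_mono_Suc_iff height_Suc)
  show ?thesis
    unfolding alcove_seqs_def mem_Collect_eq mono Int_iff simplex_iff regular_iff[symmetric]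
    using pos height_periodic height_0 by blast
qed

section \<open>Points and their coordinates\<close>

lemma eq_if_inner_simple_roots_eq:
  assumes "\<And>i. i \<in> {1..k} \<Longrightarrow> \<alpha> i \<bullet> x = \<alpha> i \<bullet> y"
  shows "x = y"
proof -
  have "orthogonal (x - y) (x - y)"
  proof (rule orthogonal_to_span)
    show "x - y \<in> span (\<alpha> ` {1..k})" using simple_roots by (simp add: simple_roots_def)
    show "orthogonal (x - y) z" if "z \<in> \<alpha> ` {1..k}" for z
      using that assms by (auto simp: orthogonal_def inner_commute inner_diff_right)
  qed
  then show ?thesis by (simp add: orthogonal_def)
qed

lemma eq_if_height_eq:
  assumes "height x = height y"
  shows "x = y"
proof (rule eq_if_inner_simple_roots_eq)
  fix i assume i: "i \<in> {1..k}"
  have "\<alpha> i \<bullet> z = height z (Suc (k - i)) - height z (k - i)" for z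
    using i gap_less[of "k - i" z] by (simp add: height_Suc)
  then show "\<alpha> i \<bullet> x = \<alpha> i \<bullet> y" using assms by simp
qed

text \<open>The vectors \<open>v i\<close> divided by \<open>m\<close> form the basis dual to the
  simple roots.\<close>

lemma inner_combination_v:
  assumes "j \<in> {1..k}"
  shows "\<alpha> j \<bullet> (\<Sum>i=1..k. (c i / real m) *\<^sub>R v i) = c j"
proof -
  have "\<alpha> j \<bullet> (\<Sum>i=1..k. (c i / real m) *\<^sub>R v i) = (\<Sum>i=1..k. if i = j then c i else 0)"
    unfolding inner_sum_right using v assms m by (intro sum.cong) auto
  then show ?thesis using assms by simp
qed

lemma height_surj:
  assumes t: "t \<in> alcove_seqs (k + 1) m"
  obtains x where "height x = t"
proof -
  \<comment> \<open>Only the gaps below index \<open>k\<close> are prescribed, through the dual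
    basis; the remaining heights agree because both sequences have the same quasi-period.\<close>
  define x where "x = (\<Sum>i=1..k. ((t (Suc (k - i)) - t (k - i)) / real m) *\<^sub>R v i)"
  have g: "gap x i = t (Suc i) - t i" if "i < k" for i
    using inner_combination_v[of "k - i" "\<lambda>i. t (Suc (k - i)) - t (k - i)"] that
    by (simp add: gap_less x_def)
  have small: "height x i = t i" if "i \<le> k" for i
    using that
  proof (induction i)
    case 0
    then show ?case using t by (simp add: alcove_seqs_def)
  next
    case (Suc i)
    then show ?case by (simp add: height_Suc g)
  qed
  have "t (i + (k + 1)) = t i + real m" for i using t by (simp add: alcove_seqs_def)
  then have t_mod: "t i = t (i mod (k + 1)) + real (i div (k + 1)) * real m" for i
    by (rule quasi_periodic_mod)
  have "height x (i mod (k + 1)) = t (i mod (k + 1))" for i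
    by (rule small) (simp add: less_Suc_eq_le[symmetric])
  then have "height x i = t i" for i using height_mod[of x i] t_mod[of i] by metis
  then show thesis using that by blast
qed

section \<open>The action of \<open>\<rho>\<close> on heights\<close>

text \<open>An affine map is determined by its values at the vertices: the translation part is
  \<open>v 1\<close>, and the linear part sends \<open>v i\<close> to the next vertex minus
  \<open>v 1\<close>. Expanding \<open>x\<close> in the \<open>v i\<close> gives the
  formula.\<close>

lemma inner_rho:
  assumes j: "j \<in> {1..k}"
  shows "\<alpha> j \<bullet> \<rho> x = (if j = 1 then real m - (\<Sum>i=1..k. \<alpha> i \<bullet> x) else \<alpha> (j - 1) \<bullet> x)"
proof -
  obtain g c where g: "linear g" and rho: "\<And>x. \<rho> x = g x + c"
    using affine unfolding affine_map_def by blast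
  have "\<rho> (v 0) = v 1" using rho_v k by auto
  then have c: "c = v 1" using rho[of 0] linear_0[OF g] v0 by simp
  \<comment> \<open>For \<open>i = k\<close> the next vertex is \<open>v 0 = 0\<close>, consistent
    with \<open>j - 1 < k\<close>; for \<open>j = 1\<close> the index \<open>j - 1\<close> is 0 and
    never equals \<open>i\<close>.\<close>
  have gv: "\<alpha> j \<bullet> g (v i) = (if i = j - 1 then real m else 0) - (if j = 1 then real m else 0)"
    if i: "i \<in> {1..k}" for i
  proof -
    have "g (v i) = v ((i + 1) mod (k + 1)) - v 1" using rho[of "v i"] rho_v i c by simp
    moreover have "\<alpha> j \<bullet> v 1 = (if j = 1 then real m else 0)" using v j k by auto
    moreover have "\<alpha> j \<bullet> v ((i + 1) mod (k + 1)) = (if i = j - 1 then real m else 0)"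
    proof (cases "i = k")
      case True
      then show ?thesis using j v0 k by auto
    next
      case False
      then have "(i + 1) mod (k + 1) = i + 1" "i + 1 \<in> {1..k}" using i by auto
      then show ?thesis using v j i by auto
    qed
    ultimately show ?thesis by (simp add: inner_diff_right)
  qed
  have "x = (\<Sum>i=1..k. ((\<alpha> i \<bullet> x) / real m) *\<^sub>R v i)"
    by (rule eq_if_inner_simple_roots_eq) (rule inner_combination_v[symmetric])
  then have "g x = g (\<Sum>i=1..k. ((\<alpha> i \<bullet> x) / real m) *\<^sub>R v i)" by (rule arg_cong)
  also have "\<dots> = (\<Sum>i=1..k. ((\<alpha> i \<bullet> x) / real m) *\<^sub>R g (v i))"
    by (simp add: linear_sum[OF g] linear_scale[OF g])
  finally have "\<rho> x = (\<Sum>i=1..k. ((\<alpha> i \<bullet> x) / real m) *\<^sub>R g (v i)) + v 1"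
    using rho[of x] c by simp
  then have "\<alpha> j \<bullet> \<rho> x = (\<Sum>i=1..k. (\<alpha> i \<bullet> x) / real m * (\<alpha> j \<bullet> g (v i))) + \<alpha> j \<bullet> v 1"
    by (simp add: inner_add_right inner_sum_right)
  also have "(\<Sum>i=1..k. (\<alpha> i \<bullet> x) / real m * (\<alpha> j \<bullet> g (v i))) =
      (\<Sum>i=1..k. (if i = j - 1 then \<alpha> i \<bullet> x else 0) - (if j = 1 then \<alpha> i \<bullet> x else 0))"
    using m by (intro sum.cong) (auto simp: gv)
  also have "\<alpha> j \<bullet> v 1 = (if j = 1 then real m else 0)" using v j k by auto
  finally show ?thesis using j by (auto simp: sum_subtractf)
qed

text \<open>Below index \<open>k\<close> this is \<open>inner_rho\<close> read in reversed order. At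
  index \<open>k\<close> it follows because the gaps of one period add up to \<open>m\<close> on
  both sides, and periodicity covers the rest.\<close>

lemma gap_rho: "gap (\<rho> x) j = gap x (Suc j)"
proof -
  have less: "gap (\<rho> x) q = gap x (Suc q)" if "q < k" for q
  proof (cases "Suc q = k")
    case True
    then have "k - q = 1" by simp
    then have "gap (\<rho> x) q = \<alpha> 1 \<bullet> \<rho> x" using gap_less[OF that, of "\<rho> x"] by simp
    then show ?thesis using inner_rho[of 1 x] k gap_k[of x] height_k[of x] True by simp
  next
    case False
    then have "k - q \<in> {1..k}" "k - q \<noteq> 1" using that by auto
    then show ?thesis using inner_rho[of "k - q" x] that False by (simp add: gap_less)
  qed
  have "height (\<rho> x) k = (\<Sum>q<k. gap x (Suc q))" by (simp add: height_def less)
  moreover have "gap x 0 + (\<Sum>q<k. gap x (Suc q)) = real m"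
    using height_periodic[of x 0] sum.lessThan_Suc_shift[of "gap x" k] by (simp add: height_def)
  ultimately have "gap (\<rho> x) k = gap x (Suc k)"
    using gap_periodic[of x 0] by (simp add: gap_k)
  then have "gap (\<rho> x) q = gap x (Suc q)" if "q \<le> k" for q
    using less[of q] that by (cases "q = k") auto
  moreover have "j mod (k + 1) \<le> k" by (simp add: less_Suc_eq_le[symmetric])
  ultimately have "gap (\<rho> x) (j mod (k + 1)) = gap x (Suc (j mod (k + 1)))" by blast
  moreover have "gap x (Suc (j mod (k + 1))) = gap x (Suc j)"
    using gap_periodic[of x "Suc i" for i] by (intro periodic_mod[of "\<lambda>j. gap x (Suc j)"]) simp
  ultimately show ?thesis using periodic_mod[of "gap (\<rho> x)" "k + 1" j, OF gap_periodic] by simp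
qed

lemma height_rho: "height (\<rho> x) = advance (height x)"
proof
  fix i
  show "height (\<rho> x) i = advance (height x) i"
    using sum.lessThan_Suc_shift[of "gap x" i] by (simp add: height_def advance_def gap_rho)
qed

lemma rho_funpow: "(\<rho> ^^ (k + 1)) x = x"
proof (rule eq_if_height_eq)
  have "height ((\<rho> ^^ d) x) = (advance ^^ d) (height x)" for d
    by (induction d) (auto simp: height_rho)
  then have "height ((\<rho> ^^ (k + 1)) x) = (\<lambda>i. height x (i + (k + 1)) - height x (0 + (k + 1)))"
    by (simp only: funpow_advance[of "height x", OF height_0] add_0)
  also have "\<dots> = height x" unfolding height_periodic by simp
  finally show "height ((\<rho> ^^ (k + 1)) x) = height x" .
qed

lemma regular_rho:
  assumes "x \<in> regular_points \<Phi>"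
  shows "\<rho> x \<in> regular_points \<Phi>"
  unfolding regular_iff
proof (intro allI impI)
  fix i j assume "height (\<rho> x) i - height (\<rho> x) j \<in> \<int>"
  then have "height x (Suc i) - height x (Suc j) \<in> \<int>" by (simp add: height_rho advance_def)
  then have "[1 + i = 1 + j] (mod (k + 1))" using assms unfolding regular_iff by simp
  then show "[i = j] (mod (k + 1))" by (simp only: cong_add_lcancel_nat)
qed

lemma rho_in_cell: "y \<in> cell \<Phi> x \<Longrightarrow> \<rho> y \<in> cell \<Phi> (\<rho> x)"
  by (simp add: mem_cell_iff regular_rho height_rho advance_def)

text \<open>For the reverse inclusion, \<open>\<rho> ^^ k\<close> is inverse to
  \<open>\<rho>\<close> and also maps cells into cells.\<close>

lemma rho_image_cell: "\<rho> ` cell \<Phi> x = cell \<Phi> (\<rho> x)"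
proof
  show "\<rho> ` cell \<Phi> x \<subseteq> cell \<Phi> (\<rho> x)" using rho_in_cell by auto
  show "cell \<Phi> (\<rho> x) \<subseteq> \<rho> ` cell \<Phi> x"
  proof
    fix z assume z: "z \<in> cell \<Phi> (\<rho> x)"
    have "(\<rho> ^^ d) z \<in> cell \<Phi> ((\<rho> ^^ d) (\<rho> x))" for d
      by (induction d) (auto simp: z rho_in_cell)
    from this[of k] have "(\<rho> ^^ k) z \<in> cell \<Phi> x"
      using rho_funpow[of x] by (simp add: funpow_swap1)
    moreover have "z = \<rho> ((\<rho> ^^ k) z)" using rho_funpow[of z] by simp
    ultimately show "z \<in> \<rho> ` cell \<Phi> x" by blast
  qed
qed

section \<open>From alcoves to center sequences\<close>

text \<open>One point in the simplex suffices for the whole cell to lie there, since the floors of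
  the gaps are constant on a cell and their signs decide membership.\<close>

lemma dilated_alcoves_eq:
  "dilated_alcoves \<Phi> k \<alpha> m = cell \<Phi> ` (regular_points \<Phi> \<inter> dilated_simplex k \<alpha> m)"
proof -
  have "x \<in> cell \<Phi> x" if "x \<in> regular_points \<Phi>" for x
    using that by (simp add: cell_def)
  moreover have "cell \<Phi> x \<subseteq> dilated_simplex k \<alpha> m" if x: "x \<in> dilated_simplex k \<alpha> m" for x
  proof
    fix y assume y: "y \<in> cell \<Phi> x"
    have "0 \<le> gap y i" for i
    proof -
      have "\<lfloor>height y (Suc i) - height y i\<rfloor> = \<lfloor>height x (Suc i) - height x i\<rfloor>"
        using y unfolding mem_cell_iff by blast
      then have "\<lfloor>gap y i\<rfloor> = \<lfloor>gap x i\<rfloor>" by (simp add: height_Suc)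
      moreover have "0 \<le> \<lfloor>gap x i\<rfloor>" using x by (simp add: simplex_iff)
      ultimately show ?thesis by linarith
    qed
    then show "y \<in> dilated_simplex k \<alpha> m" by (simp add: simplex_iff)
  qed
  ultimately show ?thesis unfolding dilated_alcoves_def alcoves_eq_cells by blast
qed

text \<open>The chosen point is immaterial: \<open>center\<close> uses only floors of height
  differences, which are constant on an alcove.\<close>

definition alcove_center :: "'a set \<Rightarrow> nat \<Rightarrow> int" where
  "alcove_center A = center (k + 1) (height (SOME x. x \<in> A))"

lemma alcove_center_cell:
  assumes "x \<in> regular_points \<Phi>"
  shows "alcove_center (cell \<Phi> x) = center (k + 1) (height x)"
proof -
  define y where "y = (SOME y. y \<in> cell \<Phi> x)"
  have "x \<in> cell \<Phi> x" using assms by (simp add: cell_def)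
  then have "y \<in> cell \<Phi> x" unfolding y_def by (rule someI)
  then have floors: "\<lfloor>height y i - height y j\<rfloor> = \<lfloor>height x i - height x j\<rfloor>" for i j
    by (simp add: mem_cell_iff)
  show ?thesis
    unfolding alcove_center_def y_def[symmetric] by (rule ext) (simp only: center_def floors)
qed

text \<open>Injectivity: the center sequence gives back all floors and so the cell. Surjectivity:
  \<open>P\<close> divided by \<open>k + 1\<close> is the height sequence of a regular point of the
  simplex, and rounding it returns \<open>P\<close>.\<close>

lemma bij_betw_alcove_center:
  "bij_betw alcove_center (dilated_alcoves \<Phi> k \<alpha> m) (center_seqs (k + 1) m)"
  unfolding bij_betw_def dilated_alcoves_eq
proof
  let ?X = "regular_points \<Phi> \<inter> dilated_simplex k \<alpha> m"
  show "inj_on alcove_center (cell \<Phi> ` ?X)"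
  proof (rule inj_onI)
    fix A B assume "A \<in> cell \<Phi> ` ?X" "B \<in> cell \<Phi> ` ?X" and eq: "alcove_center A = alcove_center B"
    then obtain x y where x: "x \<in> ?X" "A = cell \<Phi> x" and y: "y \<in> ?X" "B = cell \<Phi> y" by blast
    have "center (k + 1) (height x) = center (k + 1) (height y)"
      using eq x y alcove_center_cell by simp
    then have "\<lfloor>height x i - height x j\<rfloor> = \<lfloor>height y i - height y j\<rfloor>" for i j
      using floor_eq_center_div[of "k + 1" "height x" m, OF _ height_periodic]
        floor_eq_center_div[of "k + 1" "height y" m, OF _ height_periodic] by simp
    then show "A = B" unfolding x y by (simp add: set_eq_iff mem_cell_iff)
  qed
  show "alcove_center ` cell \<Phi> ` ?X = center_seqs (k + 1) m"
  proof
    show "alcove_center ` cell \<Phi> ` ?X \<subseteq> center_seqs (k + 1) m"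
      unfolding image_image
    proof (rule image_subsetI)
      fix x assume x: "x \<in> ?X"
      then have "center (k + 1) (height x) \<in> center_seqs (k + 1) m"
        using alcove_seqs_iff[of x] by (intro center_in_center_seqs) auto
      then show "alcove_center (cell \<Phi> x) \<in> center_seqs (k + 1) m"
        using x alcove_center_cell by simp
    qed
    show "center_seqs (k + 1) m \<subseteq> alcove_center ` cell \<Phi> ` ?X"
    proof
      fix P assume P: "P \<in> center_seqs (k + 1) m"
      let ?t = "\<lambda>i. real_of_int (P i) / real (k + 1)"
      have t: "?t \<in> alcove_seqs (k + 1) m" "center (k + 1) ?t = P"
        using center_of_center_seq[OF _ P] by auto
      obtain x where x: "height x = ?t" using height_surj[OF t(1)] .
      then have "x \<in> ?X" using t(1) alcove_seqs_iff[of x] by simp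
      moreover from this have "alcove_center (cell \<Phi> x) = P" using alcove_center_cell x t(2) by simp
      ultimately show "P \<in> alcove_center ` cell \<Phi> ` ?X" by blast
    qed
  qed
qed

lemma alcove_center_rho:
  assumes "A \<in> dilated_alcoves \<Phi> k \<alpha> m"
  shows "alcove_center (\<rho> ` A) = advance (alcove_center A)"
proof -
  obtain x where x: "x \<in> regular_points \<Phi>" "A = cell \<Phi> x"
    using assms by (auto simp: dilated_alcoves_eq)
  then show ?thesis
    using center_advance[of "height x" "k + 1" m, OF height_periodic]
    by (simp add: rho_image_cell alcove_center_cell regular_rho height_rho)
qed

theorem equivariant_bijection:
  "\<exists>F. bij_betw F (dilated_alcoves \<Phi> k \<alpha> m) (words k m) \<and>
     (\<forall>A\<in>dilated_alcoves \<Phi> k \<alpha> m. F (\<rho> ` A) = rotate1 (F A))"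
proof -
  obtain E where E: "bij_betw E (center_seqs (k + 1) m) (periodic_words (k + 1) m)"
      "\<And>P. P \<in> center_seqs (k + 1) m \<Longrightarrow> E (advance P) = shift (E P)"
    using center_seqs_words_bijection[of "k + 1" m] m by auto
  let ?F = "\<lambda>A. map (E (alcove_center A)) [0..<k + 1]"
  have "bij_betw ((\<lambda>w. map w [0..<k + 1]) \<circ> (E \<circ> alcove_center)) (dilated_alcoves \<Phi> k \<alpha> m) (words k m)"
    using bij_betw_alcove_center E(1) bij_betw_words by (blast intro: bij_betw_trans)
  then have "bij_betw ?F (dilated_alcoves \<Phi> k \<alpha> m) (words k m)" by (simp only: comp_def)
  moreover have "?F (\<rho> ` A) = rotate1 (?F A)" if A: "A \<in> dilated_alcoves \<Phi> k \<alpha> m" for A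
  proof -
    have P: "alcove_center A \<in> center_seqs (k + 1) m"
      using bij_betw_alcove_center A by (rule bij_betwE[THEN bspec])
    then have "E (alcove_center A) \<in> periodic_words (k + 1) m" using E(1) by (auto dest: bij_betwE)
    then have "E (alcove_center A) (0 + (k + 1)) = E (alcove_center A) 0"
      unfolding periodic_words_def by blast
    then show ?thesis
      unfolding alcove_center_rho[OF A] E(2)[OF P] by (intro map_shift_upt) auto
  qed
  ultimately show ?thesis by blast
qed

end

theorem theorem1p1:
  fixes k m :: nat
    and \<Phi> :: "'a::euclidean_space set"
    and \<alpha> v :: "nat \<Rightarrow> 'a"
    and \<rho> :: "'a \<Rightarrow> 'a"
  assumes "k \<ge> 1" and "m \<ge> 1"
    and "DIM('a) = k"
    and "root_system \<Phi>" and "simple_roots \<Phi> k \<alpha>" and "cartan_type_A k \<alpha>"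
    and "\<forall>r\<in>\<Phi>. r \<bullet> r = 2"
    and "v 0 = 0"
    and "\<forall>i\<in>{1..k}. \<forall>j\<in>{1..k}. \<alpha> j \<bullet> v i = (if i = j then real m else 0)"
    and "affine_map \<rho>"
    and "\<forall>i\<in>{0..k}. \<rho> (v i) = v ((i + 1) mod (k + 1))"
  shows "\<exists>F. bij_betw F (dilated_alcoves \<Phi> k \<alpha> m) (words k m) \<and>
           (\<forall>A\<in>dilated_alcoves \<Phi> k \<alpha> m. F (\<rho> ` A) = rotate1 (F A))"
proof -
  interpret type_A_simplex k m \<Phi> \<alpha> v \<rho>
    by unfold_locales (fact assms)+
  show ?thesis by (rule equivariant_bijection)
qed

end
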